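(* Let $F$ be a finite field of characteristic $2$ containing $q=2^k$ elements and let $G=C_n\times D_{12}$. If $n$ is odd, then $$U(FG)\cong C_2^{7nk}\rtimes\Bigg(C_{q-1}\times GL(2,F)\times\Big(\prod_{l>1,\ l\mid n}\big(C_{q^{d_l}-1}\times GL(2,F_{d_l})\big)^{e_l}\Big)\Bigg),$$ where $d_l=\mathrm{ord}_l(q)$ and $e_l=\phi(l)/d_l$.
   Context: $C_m$ denotes the cyclic group of order $m$, and $C_m^j$ the direct product of $j$ copies of $C_m$ (powers of groups denote direct powers). $D_{12}$ is the dihedral group of order 12, $D_{12}=\langle x,y\mid x^6=y^2=1,\ yx=x^5y\rangle$. $FG$ is the group algebra of $G$ over $F$ and $U(FG)$ is its group of units. $F_d$ denotes the extension field of $F$ of degree $d$, and $GL(2,F)$ is the general linear group of degree $2$ over $F$. For coprime integers $a$ and $m$, $\mathrm{ord}_m(a)$ is the multiplicative order of $a$ modulo $m$; $\phi$ is Euler's totient function. The product runs over all divisors $l>1$ of $n$. The symbol $A\rtimes B$ denotes a semidirect product with normal factor $A$ for some action of $B$ on $A$. *)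

theory Defs
  imports
    "HOL-Algebra.Algebra"
    "HOL-Algebra.Elementary_Groups"
    "HOL-Algebra.Product_Groups"
    "HOL-Algebra.Bij"
    "HOL-Number_Theory.Number_Theory"
begin

text \<open>Elements of \<open>R G\<close> are the finitely supported functions from \<open>G\<close> to \<open>R\<close>,
  made extensional outside of \<open>carrier G\<close>. The convolution sums over the support of
  the left factor only, because \<^const>\<open>finsum\<close> is trivial over infinite index sets.\<close>

definition group_algebra ::
    "('a, 'm) ring_scheme \<Rightarrow> ('g, 'n) monoid_scheme \<Rightarrow> ('g \<Rightarrow> 'a) ring" where
  "group_algebra R G =
     \<lparr>carrier = {f \<in> carrier G \<rightarrow>\<^sub>E carrier R. finite {g \<in> carrier G. f g \<noteq> \<zero>\<^bsub>R\<^esub>}},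
      monoid.mult = (\<lambda>f h. \<lambda>g\<in>carrier G.
        \<Oplus>\<^bsub>R\<^esub>x\<in>{x \<in> carrier G. f x \<noteq> \<zero>\<^bsub>R\<^esub>}. f x \<otimes>\<^bsub>R\<^esub> h (inv\<^bsub>G\<^esub> x \<otimes>\<^bsub>G\<^esub> g)),
      monoid.one = (\<lambda>g\<in>carrier G. if g = \<one>\<^bsub>G\<^esub> then \<one>\<^bsub>R\<^esub> else \<zero>\<^bsub>R\<^esub>),
      ring.zero = (\<lambda>g\<in>carrier G. \<zero>\<^bsub>R\<^esub>),
      ring.add = (\<lambda>f h. \<lambda>g\<in>carrier G. f g \<oplus>\<^bsub>R\<^esub> h g)\<rparr>"

definition matrix_ring :: "nat \<Rightarrow> ('a, 'm) ring_scheme \<Rightarrow> (nat \<times> nat \<Rightarrow> 'a) ring" where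
  "matrix_ring n R =
     \<lparr>carrier = {..<n} \<times> {..<n} \<rightarrow>\<^sub>E carrier R,
      monoid.mult = (\<lambda>A B. \<lambda>(i, j)\<in>{..<n} \<times> {..<n}. \<Oplus>\<^bsub>R\<^esub>k\<in>{..<n}. A (i, k) \<otimes>\<^bsub>R\<^esub> B (k, j)),
      monoid.one = (\<lambda>(i, j)\<in>{..<n} \<times> {..<n}. if i = j then \<one>\<^bsub>R\<^esub> else \<zero>\<^bsub>R\<^esub>),
      ring.zero = (\<lambda>(i, j)\<in>{..<n} \<times> {..<n}. \<zero>\<^bsub>R\<^esub>),
      ring.add = (\<lambda>A B. \<lambda>(i, j)\<in>{..<n} \<times> {..<n}. A (i, j) \<oplus>\<^bsub>R\<^esub> B (i, j))\<rparr>"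

definition GL :: "nat \<Rightarrow> ('a, 'm) ring_scheme \<Rightarrow> (nat \<times> nat \<Rightarrow> 'a) monoid" where
  "GL n R = units_of (matrix_ring n R)"

definition ring_characteristic :: "('a, 'm) ring_scheme \<Rightarrow> nat" where
  "ring_characteristic R =
     (if \<exists>m>0. add_pow R (m::nat) \<one>\<^bsub>R\<^esub> = \<zero>\<^bsub>R\<^esub>
      then LEAST m. m > 0 \<and> add_pow R m \<one>\<^bsub>R\<^esub> = \<zero>\<^bsub>R\<^esub> else 0)"

text \<open>\<open>E\<close> need not contain \<open>F\<close> as a set: it is an extension of \<open>F\<close> along some
  homomorphism, which is automatically an embedding.\<close>

definition field_extension_of_degree ::
    "('a, 'm) ring_scheme \<Rightarrow> ('b, 'n) ring_scheme \<Rightarrow> nat \<Rightarrow> bool" where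
  "field_extension_of_degree F E d \<longleftrightarrow>
     field E \<and> (\<exists>h \<in> ring_hom F E. ring.dimension E d (h ` carrier F) (carrier E))"

definition direct_power :: "('a, 'm) monoid_scheme \<Rightarrow> nat \<Rightarrow> (nat \<Rightarrow> 'a) monoid" where
  "direct_power G j = product_group {..<j} (\<lambda>_. G)"

definition semidirect_product ::
    "('a, 'm) monoid_scheme \<Rightarrow> ('b, 'n) monoid_scheme \<Rightarrow> ('b \<Rightarrow> 'a \<Rightarrow> 'a) \<Rightarrow> ('a \<times> 'b) monoid" where
  "semidirect_product A B \<alpha> =
     \<lparr>carrier = carrier A \<times> carrier B,
      monoid.mult = (\<lambda>(a, b) (a', b'). (a \<otimes>\<^bsub>A\<^esub> \<alpha> b a', b \<otimes>\<^bsub>B\<^esub> b')),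
      monoid.one = (\<one>\<^bsub>A\<^esub>, \<one>\<^bsub>B\<^esub>)\<rparr>"

definition iso_semidirect_product ::
    "('u, 'k) monoid_scheme \<Rightarrow> ('a, 'm) monoid_scheme \<Rightarrow> ('b, 'n) monoid_scheme \<Rightarrow> bool" where
  "iso_semidirect_product U A B \<longleftrightarrow>
     (\<exists>\<alpha> \<in> hom B (AutoGroup A). U \<cong> semidirect_product A B \<alpha>)"

text \<open>The generators are all elements of the type \<open>'s\<close>; the letter \<open>(s, True)\<close> stands for
  the generator \<open>s\<close> and \<open>(s, False)\<close> for its inverse. A pair \<open>(l, r)\<close> in \<open>R\<close> is
  the relation \<open>l = r\<close>.\<close>

type_synonym 's gword = "('s \<times> bool) list"

inductive gword_eq :: "('s gword \<times> 's gword) set \<Rightarrow> 's gword \<Rightarrow> 's gword \<Rightarrow> bool"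
  for R where
  refl: "gword_eq R u u"
| sym: "gword_eq R u v \<Longrightarrow> gword_eq R v u"
| trans: "gword_eq R u v \<Longrightarrow> gword_eq R v w \<Longrightarrow> gword_eq R u w"
| cancel: "gword_eq R (u @ [(s, b), (s, \<not> b)] @ v) (u @ v)"
| relation: "(l, r) \<in> R \<Longrightarrow> gword_eq R (u @ l @ v) (u @ r @ v)"

definition presented_group :: "('s gword \<times> 's gword) set \<Rightarrow> 's gword set monoid" where
  "presented_group R =
     \<lparr>carrier = UNIV // {(u, v). gword_eq R u v},
      monoid.mult = (\<lambda>A B. {w. \<exists>u\<in>A. \<exists>v\<in>B. gword_eq R (u @ v) w}),
      monoid.one = {w. gword_eq R [] w}\<rparr>"

datatype dihedral_gen = Gen_x | Gen_y

definition D12 :: "dihedral_gen gword set monoid" where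
  "D12 = (let x = (Gen_x, True); y = (Gen_y, True) in
     presented_group
       {(replicate 6 x, []), (replicate 2 y, []), ([y, x], replicate 5 x @ [y])})"

end

theory Submission
  imports Defs "HOL-Algebra.Algebraic_Closure_Type" "HOL-Library.Z2"
begin

text \<open>All finite fields of characteristic 2 embed into one algebraic closure of the field with two
  elements, with image the fixed points of a power of the Frobenius map. Evaluating the cyclic
  factor at one \<open>n\<close>-th root of unity from each Frobenius orbit sends \<open>F(C\<^sub>n \<times> D\<^sub>1\<^sub>2)\<close> into the
  product of the algebras \<open>K D\<^sub>1\<^sub>2\<close>, where \<open>K\<close> runs over the corresponding fields; this is
  injective, because a polynomial of degree less than \<open>n\<close> over \<open>F\<close> that vanishes at these roots
  vanishes at all \<open>n\<close> roots of unity, and hence bijective, by counting.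

  Since \<open>D\<^sub>1\<^sub>2 = S\<^sub>3 \<times> C\<^sub>2\<close>, the algebra \<open>K D\<^sub>1\<^sub>2\<close> is the product of
  \<open>K[C\<^sub>2 \<times> C\<^sub>2] = K[s, t] / (s\<^sup>2, t\<^sup>2)\<close> and of the \<open>2 \<times> 2\<close> matrices over
  \<open>K[C\<^sub>2] = K[\<epsilon>] / (\<epsilon>\<^sup>2)\<close>. Setting \<open>s = t = \<epsilon> = 0\<close> is a retraction onto \<open>K \<times> M\<^sub>2(K)\<close> that is
  split by the constants. The elements over the identity square to 1 in characteristic 2, and
  there are \<open>card K\<^sup>7\<close> of them; the product over all orbits is the normal factor of order
  \<open>2\<^bsup>7nk\<^esup>\<close>.\<close>

section \<open>Semidirect products of unit groups\<close>

text \<open>In the bases of the blocks, the image of each element of \<open>D12\<close> has all its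
  coordinates in the field with two elements. The map to one block is therefore given by twelve
  \<open>bit\<close>-valued functions on \<open>D12\<close>: the constant 1, \<open>b\<close>,
  \<open>g\<close> and \<open>b g\<close> from the local factor, the four matrix entries, and
  \<open>g\<close> times these entries. That the map is multiplicative becomes a rule expressing
  each function on a product through the functions on the factors; that it is injective over K
  becomes linear independence of the twelve. Both are finite checks over two elements, and K enters
  only as the set containing the coordinates. Units and semidirect products see multiplication
  alone, so only multiplicative monoids are compared. \<open>F\<close> and the extensions
  \<open>E\<close> live in unrelated types; a field with \<open>2 ^ m\<close> elements meets the
  others only through its image, the fixed points of the m-th power of Frobenius. The kernel is
  identified without generators: a group of exponent 2 is determined by its order.\<close>

lemma is_iso_sym_of_closed:
  assumes f: "f \<in> Group.iso G H"
    and closed: "\<And>x y. x \<in> carrier G \<Longrightarrow> y \<in> carrier G \<Longrightarrow> x \<otimes>\<^bsub>G\<^esub> y \<in> carrier G"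
  shows "H \<cong> G"
proof -
  have bij: "bij_betw f (carrier G) (carrier H)" and hom: "f \<in> hom G H"
    using f by (auto simp: iso_def)
  let ?g = "inv_into (carrier G) f"
  have g: "?g y \<in> carrier G" "f (?g y) = y" if "y \<in> carrier H" for y
    using bij that by (auto simp: bij_betw_def inv_into_into f_inv_into_f)
  have "?g \<in> hom H G"
  proof (rule homI)
    fix x y assume xy: "x \<in> carrier H" "y \<in> carrier H"
    have "f (?g x \<otimes>\<^bsub>G\<^esub> ?g y) = x \<otimes>\<^bsub>H\<^esub> y"
      using hom g xy by (simp add: hom_mult)
    then show "?g (x \<otimes>\<^bsub>H\<^esub> y) = ?g x \<otimes>\<^bsub>G\<^esub> ?g y"
      using closed g xy bij by (metis bij_betw_inv_into_left)
  qed (use g in auto)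
  then have "?g \<in> Group.iso H G"
    using bij by (simp add: iso_def bij_betw_inv_into)
  then show ?thesis
    by (auto simp: is_iso_def)
qed

text \<open>A split extension: \<open>c\<close> identifies A with the kernel of \<open>p\<close>,
  the section \<open>s\<close> lets B act on it by conjugation, and \<open>(a, b)\<close> is sent to
  the product of \<open>c a\<close> and \<open>s b\<close>.\<close>

lemma iso_semidirect_productI:
  assumes "group U" "group A" "group B"
    and p: "p \<in> hom U B" and s: "s \<in> hom B U"
    and ps: "\<And>b. b \<in> carrier B \<Longrightarrow> p (s b) = b"
    and c: "c \<in> hom A U" "inj_on c (carrier A)" "c ` carrier A = {u \<in> carrier U. p u = \<one>\<^bsub>B\<^esub>}"
  shows "iso_semidirect_product U A B"
proof -
  interpret U: group U by fact
  interpret A: group A by fact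
  interpret B: group B by fact
  interpret p: group_hom U B p using p by unfold_locales
  interpret s: group_hom B U s using s by unfold_locales
  interpret c: group_hom A U c using c by unfold_locales
  \<comment> \<open>Conjugation by \<open>s b\<close> on the kernel, transported to A along
    \<open>c\<close>. The restriction to the carrier is forced by \<open>AutoGroup\<close>, whose
    elements are extensional functions.\<close>
  define al where "al = (\<lambda>b. \<lambda>a\<in>carrier A. inv_into (carrier A) c (s b \<otimes>\<^bsub>U\<^esub> c a \<otimes>\<^bsub>U\<^esub> inv\<^bsub>U\<^esub> s b))"
  have pc: "p (c a) = \<one>\<^bsub>B\<^esub>" if "a \<in> carrier A" for a
    using c that by auto
  have al: "al b a \<in> carrier A" "c (al b a) = s b \<otimes>\<^bsub>U\<^esub> c a \<otimes>\<^bsub>U\<^esub> inv\<^bsub>U\<^esub> s b"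
    if "a \<in> carrier A" "b \<in> carrier B" for a b
  proof -
    have "s b \<otimes>\<^bsub>U\<^esub> c a \<otimes>\<^bsub>U\<^esub> inv\<^bsub>U\<^esub> s b \<in> c ` carrier A"
      using that by (simp add: c(3) ps pc)
    then show "al b a \<in> carrier A" "c (al b a) = s b \<otimes>\<^bsub>U\<^esub> c a \<otimes>\<^bsub>U\<^esub> inv\<^bsub>U\<^esub> s b"
      using that by (simp_all add: al_def inv_into_into f_inv_into_f)
  qed
  have cancel: "inv\<^bsub>U\<^esub> u \<otimes>\<^bsub>U\<^esub> (u \<otimes>\<^bsub>U\<^esub> v) = v" if "u \<in> carrier U" "v \<in> carrier U" for u v
    using that by (simp flip: U.m_assoc)
  have ceq: "a = a'" if "c a = c a'" "a \<in> carrier A" "a' \<in> carrier A" for a a'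
    using c(2) that by (auto dest: inj_onD)
  have al_mult: "al (b \<otimes>\<^bsub>B\<^esub> b') a = al b (al b' a)"
    if "a \<in> carrier A" "b \<in> carrier B" "b' \<in> carrier B" for a b b'
    by (rule ceq) (use that in \<open>simp_all add: al U.m_assoc U.inv_mult_group\<close>)
  have al_hom: "al b (a \<otimes>\<^bsub>A\<^esub> a') = al b a \<otimes>\<^bsub>A\<^esub> al b a'"
    if "a \<in> carrier A" "a' \<in> carrier A" "b \<in> carrier B" for a a' b
    by (rule ceq) (use that in \<open>simp_all add: al U.m_assoc cancel\<close>)
  have al_one: "al \<one>\<^bsub>B\<^esub> a = a" if "a \<in> carrier A" for a
    by (rule ceq) (use that in \<open>simp_all add: al\<close>)
  have al_inv: "al b (al (inv\<^bsub>B\<^esub> b) a) = a" if "a \<in> carrier A" "b \<in> carrier B" for a b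
    using that by (simp add: al_one flip: al_mult)
  have al_Bij: "al b \<in> Bij (carrier A)" if b: "b \<in> carrier B" for b
  proof -
    have "bij_betw (al b) (carrier A) (carrier A)"
      by (rule bij_betw_byWitness[where f' = "al (inv\<^bsub>B\<^esub> b)"])
        (use b al al_inv[of _ b] al_inv[of _ "inv\<^bsub>B\<^esub> b"] in auto)
    then show ?thesis
      by (auto simp: Bij_def al_def)
  qed
  have "al \<in> hom B (AutoGroup A)"
  proof (rule homI)
    show "al b \<in> carrier (AutoGroup A)" if "b \<in> carrier B" for b
      using that al_Bij al_hom al by (auto simp: AutoGroup_def auto_def hom_def)
    show "al (b \<otimes>\<^bsub>B\<^esub> b') = al b \<otimes>\<^bsub>AutoGroup A\<^esub> al b'"
      if "b \<in> carrier B" "b' \<in> carrier B" for b b'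
      using that al_Bij al_mult
      by (auto simp: AutoGroup_def BijGroup_def fun_eq_iff compose_def al_def)
  qed
  moreover have "U \<cong> semidirect_product A B al"
  \<comment> \<open>The natural map starts at the semidirect product, which has not been shown to be
    a group, so the isomorphism is reversed by a lemma that asks only for closure of the
    source.\<close>
  proof (rule is_iso_sym_of_closed)
    let ?f = "\<lambda>(a, b). c a \<otimes>\<^bsub>U\<^esub> s b"
    let ?S = "semidirect_product A B al"
    show "?f \<in> Group.iso ?S U"
      unfolding iso_def
    proof (intro CollectI conjI homI)
      fix x y assume "x \<in> carrier ?S" "y \<in> carrier ?S"
      then obtain a b a' b' where *: "x = (a, b)" "y = (a', b')"
        "a \<in> carrier A" "a' \<in> carrier A" "b \<in> carrier B" "b' \<in> carrier B"
        by (auto simp: semidirect_product_def)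
      have "?f (x \<otimes>\<^bsub>?S\<^esub> y) = c (a \<otimes>\<^bsub>A\<^esub> al b a') \<otimes>\<^bsub>U\<^esub> s (b \<otimes>\<^bsub>B\<^esub> b')"
        by (simp add: * semidirect_product_def)
      also have "\<dots> = ?f x \<otimes>\<^bsub>U\<^esub> ?f y"
        using *(3-) by (simp add: *(1,2) al U.m_assoc cancel)
      finally show "?f (x \<otimes>\<^bsub>?S\<^esub> y) = ?f x \<otimes>\<^bsub>U\<^esub> ?f y" .
    next
      show "bij_betw ?f (carrier ?S) (carrier U)"
        unfolding bij_betw_def
      proof
        show "inj_on ?f (carrier ?S)"
        proof (rule inj_onI)
          fix x y assume fxy: "?f x = ?f y" and "x \<in> carrier ?S" "y \<in> carrier ?S"
          from this(2,3) obtain a b a' b' where xy: "x = (a, b)" "y = (a', b')"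
            and *: "a \<in> carrier A" "a' \<in> carrier A" "b \<in> carrier B" "b' \<in> carrier B"
            by (auto simp: semidirect_product_def)
          from fxy have eq: "c a \<otimes>\<^bsub>U\<^esub> s b = c a' \<otimes>\<^bsub>U\<^esub> s b'"
            by (simp only: xy case_prod_conv)
          have "p (c a \<otimes>\<^bsub>U\<^esub> s b) = b" "p (c a' \<otimes>\<^bsub>U\<^esub> s b') = b'"
            using * by (simp_all add: ps pc)
          then have bb: "b = b'" by (simp only: eq)
          have "c a = c a'"
            using eq * unfolding bb by (metis U.r_cancel c.hom_closed s.hom_closed)
          then have "a = a'" using ceq * by blast
          with bb show "x = y" by (simp only: xy)
        qed
        show "?f ` carrier ?S = carrier U"
        proof (intro equalityI subsetI)
          fix u assume u: "u \<in> carrier U"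
          then have "u \<otimes>\<^bsub>U\<^esub> inv\<^bsub>U\<^esub> s (p u) \<in> c ` carrier A"
            by (simp add: c(3) ps)
          then obtain a where a: "a \<in> carrier A" "c a = u \<otimes>\<^bsub>U\<^esub> inv\<^bsub>U\<^esub> s (p u)"
            by auto
          then have "u = ?f (a, p u)" using u by (simp add: U.m_assoc)
          then show "u \<in> ?f ` carrier ?S"
            using a u by (force simp: semidirect_product_def)
        qed (auto simp: semidirect_product_def)
      qed
    qed (auto simp: semidirect_product_def)
    show "x \<otimes>\<^bsub>?S\<^esub> y \<in> carrier ?S" if "x \<in> carrier ?S" "y \<in> carrier ?S" for x y
      using that al by (auto simp: semidirect_product_def)
  qed
  ultimately show ?thesis
    by (auto simp: iso_semidirect_product_def)
qed

section \<open>Finite groups of exponent 2\<close>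

lemma carrier_direct_power_2: "carrier (direct_power (integer_mod_group 2) m) = {..<m} \<rightarrow>\<^sub>E {0, 1}"
proof -
  have "{0..<2::int} = {0, 1}" by auto
  then show ?thesis by (simp add: direct_power_def carrier_integer_mod_group)
qed

lemma group_direct_power: "group G \<Longrightarrow> group (direct_power G m)"
  by (simp add: direct_power_def)

text \<open>Exponent 2 forces commutativity, and a basis is built one vector at a time: an embedding
  of the i-th power of the group of order 2 has image of size \<open>2 ^ i\<close>, so for
  \<open>i < m\<close> some element lies outside and serves as the next basis vector. At
  \<open>i = m\<close> counting gives surjectivity.\<close>

lemma elementary_abelian_2_group:
  fixes G (structure)
  assumes "group G" and sq: "\<And>x. x \<in> carrier G \<Longrightarrow> x \<otimes>\<^bsub>G\<^esub> x = \<one>\<^bsub>G\<^esub>"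
    and card: "card (carrier G) = 2 ^ m"
  shows "\<exists>c \<in> hom (direct_power (integer_mod_group 2) m) G.
    inj_on c (carrier (direct_power (integer_mod_group 2) m)) \<and>
    c ` carrier (direct_power (integer_mod_group 2) m) = carrier G"
proof -
  interpret group G by fact
  have fin: "finite (carrier G)" using card by (metis card.infinite power_not_zero zero_neq_numeral)
  interpret comm_group G
  proof (rule group_comm_groupI)
    fix x y assume xy: "x \<in> carrier G" "y \<in> carrier G"
    have i: "inv z = z" if "z \<in> carrier G" for z using that sq by (simp add: inv_equality)
    show "x \<otimes> y = y \<otimes> x"
      using inv_mult_group[OF xy] xy by (simp add: i)
  qed
  let ?D = "direct_power (integer_mod_group 2)"
  have "\<exists>c \<in> hom (?D i) G. inj_on c (carrier (?D i))" if "i \<le> m" for i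
    using that
  proof (induction i)
    case 0
    have "(\<lambda>_. \<one>) \<in> hom (?D 0) G" by (auto simp: hom_def)
    moreover have "inj_on (\<lambda>_. \<one>) (carrier (?D 0))" by (simp add: carrier_direct_power_2)
    ultimately show ?case by blast
  next
    case (Suc i)
    then obtain c where c: "c \<in> hom (?D i) G" "inj_on c (carrier (?D i))" by auto
    interpret D: group "?D i" by (rule group_direct_power) simp
    interpret c: group_hom "?D i" G c
      using c by unfold_locales simp
    have "card (c ` carrier (?D i)) = 2 ^ i"
      using c(2) by (simp add: card_image carrier_direct_power_2 card_PiE numeral_2_eq_2[symmetric])
    also have "\<dots> < card (carrier G)" using Suc.prems by (simp add: card)
    finally have "c ` carrier (?D i) \<noteq> carrier G" by auto
    moreover have "c ` carrier (?D i) \<subseteq> carrier G" by auto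
    ultimately obtain g where g: "g \<in> carrier G" "g \<notin> c ` carrier (?D i)" by auto
    define c' where "c' v = c (restrict v {..<i}) \<otimes> (if v i = 0 then \<one> else g)" for v
    have r: "restrict v {..<i} \<in> carrier (?D i)" if "v \<in> carrier (?D (Suc i))" for v
      using that by (auto simp: carrier_direct_power_2 PiE_def Pi_def)
    have v01: "v i = 0 \<or> v i = 1" if "v \<in> carrier (?D (Suc i))" for v
      using that by (force simp: carrier_direct_power_2 PiE_def Pi_def)
    have "c' \<in> hom (?D (Suc i)) G"
    proof (rule homI)
      fix v w assume vw: "v \<in> carrier (?D (Suc i))" "w \<in> carrier (?D (Suc i))"
      have e: "restrict (v \<otimes>\<^bsub>?D (Suc i)\<^esub> w) {..<i} = restrict v {..<i} \<otimes>\<^bsub>?D i\<^esub> restrict w {..<i}"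
        by (auto simp: direct_power_def fun_eq_iff)
      have "c (restrict (v \<otimes>\<^bsub>?D (Suc i)\<^esub> w) {..<i}) = c (restrict v {..<i}) \<otimes> c (restrict w {..<i})"
        unfolding e by (rule c.hom_mult) (use r vw in auto)
      moreover have "(v \<otimes>\<^bsub>?D (Suc i)\<^esub> w) i = (v i + w i) mod 2" by (simp add: direct_power_def)
      moreover have "c (restrict v {..<i}) \<in> carrier G" "c (restrict w {..<i}) \<in> carrier G"
        using r vw by auto
      moreover have "g \<otimes> (x \<otimes> g) = x" if "x \<in> carrier G" for x
        using that g sq by (simp add: m_comm[of x g] flip: m_assoc)
      ultimately show "c' (v \<otimes>\<^bsub>?D (Suc i)\<^esub> w) = c' v \<otimes> c' w"
        using v01[OF vw(1)] v01[OF vw(2)] g sq by (auto simp: c'_def m_ac)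
    qed (use r g in \<open>auto simp: c'_def\<close>)
    moreover have "inj_on c' (carrier (?D (Suc i)))"
    proof (rule inj_onI)
      fix v w assume vw: "v \<in> carrier (?D (Suc i))" "w \<in> carrier (?D (Suc i))" and eq: "c' v = c' w"
      have *: "a \<otimes> inv b \<in> c ` carrier (?D i)"
        if "a \<in> c ` carrier (?D i)" "b \<in> c ` carrier (?D i)" for a b
        using that by (auto simp flip: c.hom_inv c.hom_mult)
      \<comment> \<open>Two vectors with the same image but different last coordinates would express
        \<open>g\<close> as a quotient of elements of the old image, which is a subgroup avoiding
        \<open>g\<close>.\<close>
      have **: "c (restrict v {..<i}) \<otimes> g \<noteq> c (restrict w {..<i})"
        if "v \<in> carrier (?D (Suc i))" "w \<in> carrier (?D (Suc i))" for v w
      proof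
        assume "c (restrict v {..<i}) \<otimes> g = c (restrict w {..<i})"
        then have "g = c (restrict w {..<i}) \<otimes> inv (c (restrict v {..<i}))"
          using g r that by (metis c.hom_closed inv_solve_right' m_comm)
        then show False using g * r that by auto
      qed
      have vwi: "v i = w i"
      proof (rule ccontr)
        assume "v i \<noteq> w i"
        then show False
          using v01[OF vw(1)] v01[OF vw(2)] eq **[OF vw] **[OF vw(2) vw(1)] r vw
          by (auto simp: c'_def)
      qed
      then have "c (restrict v {..<i}) = c (restrict w {..<i})"
        using eq r[OF vw(1)] r[OF vw(2)] g by (auto simp: c'_def split: if_splits)
      then have "restrict v {..<i} = restrict w {..<i}"
        using c(2) r vw by (auto dest: inj_onD)
      then have "v j = w j" if "j < i" for j
        using that by (metis lessThan_iff restrict_apply')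
      then show "v = w"
        using vw vwi unfolding carrier_direct_power_2
        by (intro PiE_ext[of v _ _ w]) (auto simp: less_Suc_eq)
    qed
    ultimately show ?case by blast
  qed
  then obtain c where c: "c \<in> hom (?D m) G" "inj_on c (carrier (?D m))" by auto
  have "c ` carrier (?D m) \<subseteq> carrier G" using c(1) by (auto simp: hom_def)
  moreover have "card (c ` carrier (?D m)) = card (carrier G)"
    using c(2) by (simp add: card card_image carrier_direct_power_2 card_PiE numeral_2_eq_2[symmetric])
  ultimately have "c ` carrier (?D m) = carrier G" using fin by (simp add: card_subset_eq)
  with c show ?thesis by blast
qed

section \<open>Passing from monoids to their units\<close>

lemma hom_units_of:
  assumes "monoid G" "monoid H" "f \<in> hom G H" "f \<one>\<^bsub>G\<^esub> = \<one>\<^bsub>H\<^esub>"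
  shows "f \<in> hom (units_of G) (units_of H)"
proof (rule homI)
  fix x assume "x \<in> carrier (units_of G)"
  then obtain y where "x \<in> carrier G" "y \<in> carrier G" "x \<otimes>\<^bsub>G\<^esub> y = \<one>\<^bsub>G\<^esub>" "y \<otimes>\<^bsub>G\<^esub> x = \<one>\<^bsub>G\<^esub>"
    by (auto simp: units_of_def Units_def)
  then have "f x \<in> carrier H" "f y \<in> carrier H" "f x \<otimes>\<^bsub>H\<^esub> f y = \<one>\<^bsub>H\<^esub>" "f y \<otimes>\<^bsub>H\<^esub> f x = \<one>\<^bsub>H\<^esub>"
    using assms(3,4) hom_mult[OF assms(3)] by (metis hom_in_carrier)+
  then show "f x \<in> carrier (units_of H)" by (auto simp: units_of_def Units_def)
next
  fix x y assume "x \<in> carrier (units_of G)" "y \<in> carrier (units_of G)"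
  then show "f (x \<otimes>\<^bsub>units_of G\<^esub> y) = f x \<otimes>\<^bsub>units_of H\<^esub> f y"
    using assms(3) by (auto simp: units_of_def Units_def hom_mult)
qed

lemma units_of_is_iso:
  assumes "monoid G" "monoid H" "f \<in> Group.iso G H"
  shows "units_of G \<cong> units_of H"
proof -
  interpret G: monoid G by fact
  interpret H: monoid H by fact
  let ?g = "inv_into (carrier G) f"
  have bij: "bij_betw f (carrier G) (carrier H)" and hom: "f \<in> hom G H"
    using assms(3) by (auto simp: iso_def)
  have g: "?g y \<in> carrier G" "f (?g y) = y" if "y \<in> carrier H" for y
    using bij that by (auto simp: bij_betw_def inv_into_into f_inv_into_f)
  have gf: "?g (f x) = x" if "x \<in> carrier G" for x
    using bij that by (simp add: bij_betw_inv_into_left)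
  \<comment> \<open>A multiplicative map of monoids may move the unit. Surjectivity prevents this:
    multiplying \<open>f\<close> of the unit by \<open>f\<close> of a preimage of the unit gives
    that unit back.\<close>
  have f1: "f \<one>\<^bsub>G\<^esub> = \<one>\<^bsub>H\<^esub>"
    using g[of "\<one>\<^bsub>H\<^esub>"] hom hom_mult[OF hom, of "\<one>\<^bsub>G\<^esub>" "?g \<one>\<^bsub>H\<^esub>"] hom_in_carrier[OF hom] by simp
  have ghom: "?g \<in> hom H G"
  proof (rule homI)
    fix x y assume xy: "x \<in> carrier H" "y \<in> carrier H"
    have "f (?g x \<otimes>\<^bsub>G\<^esub> ?g y) = x \<otimes>\<^bsub>H\<^esub> y"
      using hom g xy by (simp add: hom_mult)
    then show "?g (x \<otimes>\<^bsub>H\<^esub> y) = ?g x \<otimes>\<^bsub>G\<^esub> ?g y"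
      using G.m_closed g xy gf by metis
  qed (use g in auto)
  have "f \<in> hom (units_of G) (units_of H)" "?g \<in> hom (units_of H) (units_of G)"
    using hom_units_of[OF assms(1,2) hom f1] hom_units_of[OF assms(2,1) ghom] gf[of "\<one>\<^bsub>G\<^esub>"] by (simp_all add: f1)
  then have "f \<in> Group.iso (units_of G) (units_of H)"
    unfolding iso_def
    by (auto intro!: bij_betw_byWitness[where f' = ?g] gf g G.Units_closed H.Units_closed
        simp: hom_def units_of_carrier)
  then show ?thesis by (auto simp: is_iso_def)
qed

text \<open>The hypotheses speak of the monoids V and H only. By \<open>sq\<close> every element of
  V over the unit of H is its own inverse, so the whole fibre consists of units and equals the
  kernel of the induced map of unit groups; it has exponent 2 and \<open>2 ^ m\<close>
  elements.\<close>

lemma iso_semidirect_product_units_of: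
  assumes "monoid V" "monoid H"
    and p: "p \<in> hom V H" "p \<one>\<^bsub>V\<^esub> = \<one>\<^bsub>H\<^esub>" and s: "s \<in> hom H V" "s \<one>\<^bsub>H\<^esub> = \<one>\<^bsub>V\<^esub>"
    and ps: "\<And>h. h \<in> carrier H \<Longrightarrow> p (s h) = h"
    and sq: "\<And>v. v \<in> carrier V \<Longrightarrow> p v = \<one>\<^bsub>H\<^esub> \<Longrightarrow> v \<otimes>\<^bsub>V\<^esub> v = \<one>\<^bsub>V\<^esub>"
    and card: "card {v \<in> carrier V. p v = \<one>\<^bsub>H\<^esub>} = 2 ^ m"
    and "group B" "units_of H \<cong> B"
  shows "iso_semidirect_product (units_of V) (direct_power (integer_mod_group 2) m) B"
proof -
  interpret V: monoid V by fact
  interpret H: monoid H by fact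
  interpret B: group B by fact
  interpret UV: group "units_of V" by (rule V.units_group)
  interpret UH: group "units_of H" by (rule H.units_group)
  from \<open>units_of H \<cong> B\<close> obtain f where f: "f \<in> Group.iso (units_of H) B" by (auto simp: is_iso_def)
  interpret f: group_hom "units_of H" B f using f by unfold_locales (auto simp: iso_def)
  define g where "g = inv_into (carrier (units_of H)) f"
  have g: "g \<in> hom B (units_of H)"
    using UH.iso_set_sym[OF f] by (simp add: g_def iso_def)
  have fb: "bij_betw f (carrier (units_of H)) (carrier B)" using f by (auto simp: iso_def)
  have pU: "p \<in> hom (units_of V) (units_of H)" and sU: "s \<in> hom (units_of H) (units_of V)"
    using hom_units_of assms by blast+
  interpret pU: group_hom "units_of V" "units_of H" p using pU by unfold_locales
  let ?N = "{u \<in> carrier (units_of V). p u = \<one>\<^bsub>units_of H\<^esub>}"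
  have N: "?N = {v \<in> carrier V. p v = \<one>\<^bsub>H\<^esub>}"
    using sq by (auto simp: units_of_def Units_def)
  have N': "?N = kernel (units_of V) (units_of H) p" by (simp add: kernel_def)
  have "subgroup ?N (units_of V)" unfolding N' by (rule pU.subgroup_kernel)
  then have grpN: "group ((units_of V)\<lparr>carrier := ?N\<rparr>)" by (rule UV.subgroup_imp_group)
  let ?D = "direct_power (integer_mod_group 2) m"
  have "\<exists>c\<in>hom ?D ((units_of V)\<lparr>carrier := ?N\<rparr>). inj_on c (carrier ?D) \<and>
      c ` carrier ?D = carrier ((units_of V)\<lparr>carrier := ?N\<rparr>)"
    by (rule elementary_abelian_2_group[OF grpN])
      (use sq card N in \<open>auto simp: units_of_def Units_def\<close>)
  then obtain c where c: "c \<in> hom ?D ((units_of V)\<lparr>carrier := ?N\<rparr>)" "inj_on c (carrier ?D)"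
    "c ` carrier ?D = ?N" by auto
  show ?thesis
  proof (rule iso_semidirect_productI)
    show "f \<circ> p \<in> hom (units_of V) B" using pU f.homh by (rule hom_compose)
    show "s \<circ> g \<in> hom B (units_of V)" using g sU by (rule hom_compose)
    show "(f \<circ> p) ((s \<circ> g) b) = b" if "b \<in> carrier B" for b
    proof -
      have "g b \<in> carrier (units_of H)" using g that by (auto simp: hom_def)
      then have "p (s (g b)) = g b" using ps by (auto simp: units_of_def)
      then show ?thesis using that fb by (simp add: g_def bij_betw_inv_into_right)
    qed
    show "c \<in> hom ?D (units_of V)" using c(1) by (auto simp: hom_def)
    show "inj_on c (carrier ?D)" by fact
    have "f h = \<one>\<^bsub>B\<^esub> \<longleftrightarrow> h = \<one>\<^bsub>units_of H\<^esub>" if "h \<in> carrier (units_of H)" for h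
      using that fb f.hom_one by (metis UH.one_closed bij_betw_inv_into_left)
    then show "c ` carrier ?D = {u \<in> carrier (units_of V). (f \<circ> p) u = \<one>\<^bsub>B\<^esub>}"
      unfolding c(3) using pU.hom_closed by auto
  qed (auto intro: group_direct_power \<open>group B\<close> UV.is_group)
qed

lemma iso_semidirect_product_trans:
  assumes "U \<cong> V" "iso_semidirect_product V A B"
  shows "iso_semidirect_product U A B"
  using assms iso_trans by (auto simp: iso_semidirect_product_def)

section \<open>Units of direct products of monoids\<close>

lemma monoid_product_group:
  assumes "\<And>i. i \<in> I \<Longrightarrow> monoid (M i)"
  shows "monoid (product_group I M)"
proof (rule monoidI)
  fix x y z assume "x \<in> carrier (product_group I M)" "y \<in> carrier (product_group I M)" "z \<in> carrier (product_group I M)"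
  then have "x i \<in> carrier (M i) \<and> y i \<in> carrier (M i) \<and> z i \<in> carrier (M i)" if "i \<in> I" for i
    using that by (auto simp: PiE_iff)
  then have "x i \<otimes>\<^bsub>M i\<^esub> y i \<otimes>\<^bsub>M i\<^esub> z i = x i \<otimes>\<^bsub>M i\<^esub> (y i \<otimes>\<^bsub>M i\<^esub> z i)" if "i \<in> I" for i
    using that assms monoid.m_assoc by metis
  then show "x \<otimes>\<^bsub>product_group I M\<^esub> y \<otimes>\<^bsub>product_group I M\<^esub> z = x \<otimes>\<^bsub>product_group I M\<^esub> (y \<otimes>\<^bsub>product_group I M\<^esub> z)"
    by (simp add: fun_eq_iff)
next
  fix x assume "x \<in> carrier (product_group I M)"
  then have x: "x i \<in> carrier (M i)" if "i \<in> I" for i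
    using that by (auto simp: PiE_iff)
  have ext: "x \<in> extensional I" using \<open>x \<in> _\<close> by (simp add: PiE_iff)
  have "\<one>\<^bsub>M i\<^esub> \<otimes>\<^bsub>M i\<^esub> x i = x i" "x i \<otimes>\<^bsub>M i\<^esub> \<one>\<^bsub>M i\<^esub> = x i" if "i \<in> I" for i
    using that assms x monoid.l_one monoid.r_one by metis+
  then show "\<one>\<^bsub>product_group I M\<^esub> \<otimes>\<^bsub>product_group I M\<^esub> x = x" "x \<otimes>\<^bsub>product_group I M\<^esub> \<one>\<^bsub>product_group I M\<^esub> = x"
    using ext by (auto simp: fun_eq_iff extensional_def)
qed (use assms in \<open>auto simp: PiE_iff intro: monoid.m_closed monoid.one_closed\<close>)

lemma units_of_product_group:
  assumes "\<And>i. i \<in> I \<Longrightarrow> monoid (M i)"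
  shows "units_of (product_group I M) = product_group I (\<lambda>i. units_of (M i))"
proof -
  have "Units (product_group I M) = (\<Pi>\<^sub>E i\<in>I. Units (M i))"
  proof (intro equalityI subsetI)
    fix x assume "x \<in> Units (product_group I M)"
    then obtain y where xy: "x \<in> carrier (product_group I M)" "y \<in> carrier (product_group I M)"
      and eq: "y \<otimes>\<^bsub>product_group I M\<^esub> x = \<one>\<^bsub>product_group I M\<^esub>" "x \<otimes>\<^bsub>product_group I M\<^esub> y = \<one>\<^bsub>product_group I M\<^esub>"
      by (auto simp: Units_def)
    have "y i \<otimes>\<^bsub>M i\<^esub> x i = \<one>\<^bsub>M i\<^esub>" "x i \<otimes>\<^bsub>M i\<^esub> y i = \<one>\<^bsub>M i\<^esub>" if "i \<in> I" for i
      using fun_cong[OF eq(1), of i] fun_cong[OF eq(2), of i] that by auto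
    then show "x \<in> (\<Pi>\<^sub>E i\<in>I. Units (M i))"
      using xy unfolding Units_def PiE_iff carrier_product_group by blast
  next
    fix x assume x: "x \<in> (\<Pi>\<^sub>E i\<in>I. Units (M i))"
    then have "\<forall>i\<in>I. \<exists>y. y \<in> carrier (M i) \<and> y \<otimes>\<^bsub>M i\<^esub> x i = \<one>\<^bsub>M i\<^esub> \<and> x i \<otimes>\<^bsub>M i\<^esub> y = \<one>\<^bsub>M i\<^esub>"
      by (auto simp: Units_def PiE_iff)
    then obtain y where "\<forall>i\<in>I. y i \<in> carrier (M i) \<and> y i \<otimes>\<^bsub>M i\<^esub> x i = \<one>\<^bsub>M i\<^esub> \<and> x i \<otimes>\<^bsub>M i\<^esub> y i = \<one>\<^bsub>M i\<^esub>"
      by metis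
    then show "x \<in> Units (product_group I M)"
      using x by (auto simp: Units_def PiE_iff intro!: bexI[of _ "restrict y I"])
  qed
  then show ?thesis
    by (simp add: units_of_def product_group_def)
qed

lemma units_of_DirProd:
  shows "units_of (G \<times>\<times> H) = units_of G \<times>\<times> units_of H"
proof -
  have "Units (G \<times>\<times> H) = Units G \<times> Units H"
    by (auto simp: Units_def DirProd_def)
  then show ?thesis
    by (simp add: units_of_def DirProd_def)
qed

section \<open>Finite fields of characteristic 2\<close>

text \<open>The bridge from rings with an explicit carrier to a type-class field, where polynomials,
  roots and finite sums can be handled. Injectivity is built in because R itself need only be a
  ring.\<close>

definition field_embedding :: "('a, 'm) ring_scheme \<Rightarrow> ('a \<Rightarrow> 'r::field) \<Rightarrow> bool" where
  "field_embedding R \<psi> \<longleftrightarrow>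
     (\<forall>x\<in>carrier R. \<forall>y\<in>carrier R. \<psi> (x \<oplus>\<^bsub>R\<^esub> y) = \<psi> x + \<psi> y \<and> \<psi> (x \<otimes>\<^bsub>R\<^esub> y) = \<psi> x * \<psi> y) \<and>
     \<psi> \<one>\<^bsub>R\<^esub> = 1 \<and> inj_on \<psi> (carrier R)"

context
  fixes R :: "('a, 'm) ring_scheme" (structure) and \<psi> :: "'a \<Rightarrow> 'r::field"
  assumes ring: "ring R" and emb: "field_embedding R \<psi>"
begin

interpretation ring R by (rule ring)

lemma field_embedding_add: "x \<in> carrier R \<Longrightarrow> y \<in> carrier R \<Longrightarrow> \<psi> (x \<oplus> y) = \<psi> x + \<psi> y"
  and field_embedding_mult: "x \<in> carrier R \<Longrightarrow> y \<in> carrier R \<Longrightarrow> \<psi> (x \<otimes> y) = \<psi> x * \<psi> y"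
  and field_embedding_one: "\<psi> \<one> = 1"
  and field_embedding_inj: "inj_on \<psi> (carrier R)"
  using emb by (auto simp: field_embedding_def)

lemma field_embedding_zero: "\<psi> \<zero> = 0"
  using field_embedding_add[of \<zero> \<zero>] by (metis add_cancel_left_left l_zero zero_closed)

lemma field_embedding_eq_0_iff: "x \<in> carrier R \<Longrightarrow> \<psi> x = 0 \<longleftrightarrow> x = \<zero>"
  using field_embedding_zero field_embedding_inj by (metis inj_on_eq_iff zero_closed)

lemma field_embedding_finsum:
  "f \<in> A \<rightarrow> carrier R \<Longrightarrow> finite A \<Longrightarrow> \<psi> (\<Oplus>i\<in>A. f i) = (\<Sum>i\<in>A. \<psi> (f i))"
proof (induction A rule: infinite_finite_induct)
  case (insert x A)
  then have "\<psi> (\<Oplus>i\<in>insert x A. f i) = \<psi> (f x \<oplus> (\<Oplus>i\<in>A. f i))"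
    by (subst finsum_insert) auto
  also have "\<dots> = \<psi> (f x) + \<psi> (\<Oplus>i\<in>A. f i)"
    using insert by (intro field_embedding_add finsum_closed) auto
  finally show ?case using insert by (simp add: Pi_def)
qed (auto simp: field_embedding_zero)

end

text \<open>Horner evaluation at \<open>t\<close>. Sending the bits to zero and one of R respects
  addition only because R is assumed below to have characteristic 2.\<close>

definition bit_poly_eval :: "('a, 'm) ring_scheme \<Rightarrow> 'a \<Rightarrow> bit poly \<Rightarrow> 'a" where
  "bit_poly_eval R t p =
     fold_coeffs (\<lambda>c v. (if c = 0 then \<zero>\<^bsub>R\<^esub> else \<one>\<^bsub>R\<^esub>) \<oplus>\<^bsub>R\<^esub> t \<otimes>\<^bsub>R\<^esub> v) p \<zero>\<^bsub>R\<^esub>"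

context
  fixes R :: "('a, 'm) ring_scheme" (structure) and t
  assumes field: "field R" and two: "\<one> \<oplus> \<one> = \<zero>" and t: "t \<in> carrier R"
begin

interpretation field R by (rule field)

lemma bit_poly_eval_0: "bit_poly_eval R t 0 = \<zero>"
  by (simp add: bit_poly_eval_def)

lemma bit_poly_eval_pCons:
  "bit_poly_eval R t (pCons c p) = (if c = 0 then \<zero> else \<one>) \<oplus> t \<otimes> bit_poly_eval R t p"
proof (cases "c = 0 \<and> p = 0")
  case True
  then show ?thesis using t by (simp add: bit_poly_eval_0)
next
  case False
  then have "pCons c p \<noteq> 0" by auto
  then show ?thesis using False by (auto simp: bit_poly_eval_def fold_coeffs_def coeffs_pCons_eq_cCons cCons_def)
qed

lemma bit_poly_eval_closed: "bit_poly_eval R t p \<in> carrier R"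
  by (induction p) (auto simp: bit_poly_eval_0 bit_poly_eval_pCons t)

lemma bit_poly_eval_add: "bit_poly_eval R t (p + p') = bit_poly_eval R t p \<oplus> bit_poly_eval R t p'"
proof (induction p p' rule: poly_induct2)
  case (pCons a p b p')
  have "(if a + b = 0 then \<zero> else \<one>) = (if a = 0 then \<zero> else \<one>) \<oplus> (if b = 0 then \<zero> else \<one>)"
    by (cases a; cases b) (auto simp: two)
  then show ?case
    using t by (simp add: bit_poly_eval_pCons pCons r_distr a_ac bit_poly_eval_closed del: add_bit_eq_xor)
qed (simp add: bit_poly_eval_0)

lemma bit_poly_eval_mult: "bit_poly_eval R t (p * p') = bit_poly_eval R t p \<otimes> bit_poly_eval R t p'"
proof (induction p)
  case (pCons a p)
  have "bit_poly_eval R t (smult a p') = (if a = 0 then \<zero> else \<one>) \<otimes> bit_poly_eval R t p'"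
    by (cases a) (auto simp: bit_poly_eval_0 bit_poly_eval_closed)
  moreover have "bit_poly_eval R t (pCons 0 (p * p')) = t \<otimes> bit_poly_eval R t p \<otimes> bit_poly_eval R t p'"
    using t by (simp add: bit_poly_eval_pCons pCons bit_poly_eval_closed m_assoc)
  ultimately show ?case
    using t by (simp add: bit_poly_eval_add bit_poly_eval_pCons bit_poly_eval_closed l_distr)
qed (simp add: bit_poly_eval_0 bit_poly_eval_closed)

lemma bit_poly_eval_one: "bit_poly_eval R t 1 = \<one>"
  using t by (simp add: one_pCons bit_poly_eval_pCons bit_poly_eval_0)

lemma bit_poly_eval_X_power: "bit_poly_eval R t ([:0, 1:] ^ i) = t [^] i"
proof (induction i)
  case (Suc i)
  have "bit_poly_eval R t [:0, 1:] = t" using t by (simp add: bit_poly_eval_pCons bit_poly_eval_0)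
  then show ?case using Suc t by (simp add: bit_poly_eval_mult m_comm del: mult_pCons_left)
qed (simp add: bit_poly_eval_one)

end

lemma card_roots_of_power_eq_self:
  fixes N :: nat
  assumes "N > 1"
  shows "finite {x :: 'r::field. x ^ N = x}" "card {x :: 'r. x ^ N = x} \<le> N"
proof -
  let ?p = "Polynomial.monom 1 N - [:0, 1::'r:]"
  have "Polynomial.coeff ?p N = 1" using assms by (simp add: coeff_pCons split: nat.split)
  then have p0: "?p \<noteq> 0" by (metis coeff_0 zero_neq_one)
  have eq: "{x :: 'r. x ^ N = x} = {x. poly ?p x = 0}" by (simp add: poly_monom)
  show "finite {x :: 'r. x ^ N = x}" unfolding eq by (rule poly_roots_finite[OF p0])
  have "Polynomial.degree ?p \<le> N"
    using assms by (intro degree_diff_le) (auto simp: degree_monom_le)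
  then show "card {x :: 'r. x ^ N = x} \<le> N"
    unfolding eq using card_poly_roots_bound[OF p0] by linarith
qed

text \<open>A generator \<open>t\<close> of the multiplicative group also generates R as an algebra
  over the field with two elements, so R is the quotient of the polynomial ring by the multiples of
  a least-degree relation \<open>m\<close> of \<open>t\<close>. Sending \<open>t\<close> to a root
  of \<open>m\<close> in the closure gives the embedding; it is injective because nonzero elements
  are invertible.\<close>

theorem finite_field_embedding:
  fixes R :: "('a, 'm) ring_scheme" (structure)
  assumes "field R" and fin: "finite (carrier R)" and two: "\<one> \<oplus> \<one> = \<zero>"
  obtains \<psi> :: "'a \<Rightarrow> bit alg_closure" where
    "field_embedding R \<psi>" "\<psi> ` carrier R = {x. x ^ card (carrier R) = x}"
proof -
  interpret field R by fact
  obtain t where t: "t \<in> carrier (Multiplicative_Group.mult_of R)" "carrier (Multiplicative_Group.mult_of R) = {t [^] i | i::nat. i \<in> UNIV}"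
    using finite_field_mult_group_has_gen[OF fin] by auto
  have tc: "t \<in> carrier R" using t by simp
  define ev where "ev = bit_poly_eval R t"
  note ev_simps = bit_poly_eval_0[OF \<open>field R\<close> two tc, folded ev_def]
    bit_poly_eval_pCons[OF \<open>field R\<close> two tc, folded ev_def]
    bit_poly_eval_closed[OF \<open>field R\<close> two tc, folded ev_def]
    bit_poly_eval_add[OF \<open>field R\<close> two tc, folded ev_def]
    bit_poly_eval_mult[OF \<open>field R\<close> two tc, folded ev_def]
    bit_poly_eval_one[OF \<open>field R\<close> two tc, folded ev_def]
    bit_poly_eval_X_power[OF \<open>field R\<close> two tc, folded ev_def]
  have surj: "\<exists>p. ev p = x" if "x \<in> carrier R" for x
  proof (cases "x = \<zero>")
    case False
    then have "x \<in> carrier (Multiplicative_Group.mult_of R)" using that by simp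
    then obtain i :: nat where "x = t [^] i" using t by auto
    then show ?thesis using ev_simps by metis
  qed (use ev_simps in metis)
  \<comment> \<open>Two equal powers of \<open>t\<close> yield a nonzero polynomial, the difference
    of two distinct powers of X, that vanishes at \<open>t\<close>; hence \<open>m\<close>
    exists.\<close>
  have "\<not> inj (\<lambda>i::nat. t [^] i)"
    using fin by (metis (mono_tags, lifting) finite_imageD finite_subset image_subsetI infinite_UNIV_nat nat_pow_closed tc)
  then obtain i j :: nat where ij: "i < j" "t [^] i = t [^] j"
    unfolding inj_def by (metis linorder_neqE_nat)
  have neg: "\<ominus> x = x" if "x \<in> carrier R" for x
  proof -
    have "x \<oplus> x = (\<one> \<oplus> \<one>) \<otimes> x" using that by (simp add: l_distr)
    then show ?thesis using that two minus_equality by simp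
  qed
  have ker_diff: "ev (p - p') = \<zero> \<longleftrightarrow> ev p = ev p'" for p p'
  proof -
    have "- p' = p'" by (rule poly_eqI) simp
    then have "ev (p - p') = ev p \<oplus> ev p'" using ev_simps by (metis diff_conv_add_uminus)
    then show ?thesis using ev_simps neg by (metis minus_equality r_neg)
  qed
  have "ev ([:0, 1:] ^ j - [:0, 1:] ^ i) = \<zero>" using ij ker_diff by (simp add: ev_simps)
  moreover have "[:0, 1::bit:] ^ j \<noteq> [:0, 1:] ^ i"
    using ij(1) degree_linear_power[of "0::bit"] by (metis less_irrefl)
  ultimately have "\<exists>p. p \<noteq> 0 \<and> ev p = \<zero>" by (metis right_minus_eq)
  then obtain m where m: "m \<noteq> 0" "ev m = \<zero>"
    and least: "\<And>p. p \<noteq> 0 \<Longrightarrow> ev p = \<zero> \<Longrightarrow> Polynomial.degree m \<le> Polynomial.degree p"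
    using ex_has_least_nat[of "\<lambda>p. p \<noteq> 0 \<and> ev p = \<zero>" _ Polynomial.degree] by blast
  have m_dvd: "m dvd p" if "ev p = \<zero>" for p
  proof -
    have "ev p = ev (m * (p div m) + p mod m)" by simp
    also have "\<dots> = ev (p mod m)" unfolding ev_simps(4,5) using m ev_simps by simp
    finally have "ev (p mod m) = \<zero>" using that by simp
    then have "p mod m = 0"
      using least[of "p mod m"] degree_mod_less'[OF m(1)] by (meson not_le)
    then show ?thesis by auto
  qed
  \<comment> \<open>Only a nonconstant polynomial is guaranteed a root in the closure. A nonzero
    constant evaluates to the unit of R and so is no relation of \<open>t\<close>.\<close>
  have "Polynomial.degree m > 0"
  proof (rule ccontr)
    assume "\<not> Polynomial.degree m > 0"
    then obtain c where "m = [:c:]" by (meson degree_eq_zeroE not_gr_zero)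
    then show False using m by (auto simp: ev_simps tc)
  qed
  then have "Polynomial.degree (map_poly to_ac m) > 0" by (simp add: degree_map_poly)
  then obtain w where w: "poly (map_poly to_ac m) w = 0"
    using alg_closed_imp_poly_has_root by blast
  define pw where "pw p = poly (map_poly to_ac p) w" for p :: "bit poly"
  have pw_add: "pw (p + p') = pw p + pw p'" for p p'
  proof -
    have "map_poly to_ac (p + p') = map_poly to_ac p + map_poly to_ac p'"
      by (rule poly_eqI) (simp add: coeff_map_poly del: add_bit_eq_xor)
    then show ?thesis by (simp add: pw_def)
  qed
  have pw_mult: "pw (p * p') = pw p * pw p'" for p p'
  proof -
    have "map_poly to_ac (p * p') = map_poly to_ac p * map_poly to_ac p'"
      by (rule poly_eqI) (simp add: coeff_map_poly coeff_mult to_ac_sum del: mult_bit_eq_and flip: to_ac_mult)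
    then show ?thesis by (simp add: pw_def)
  qed
  have pw_eq: "pw p = pw p'" if "ev p = ev p'" for p p'
  proof -
    have "ev (p - p') = \<zero>" using that ker_diff by simp
    then obtain r where "p - p' = m * r" using m_dvd by (metis dvdE)
    then have "p = m * r + p'" by (simp add: algebra_simps)
    then show ?thesis by (simp add: pw_add pw_mult) (simp add: pw_def w)
  qed
  \<comment> \<open>Any two polynomials with the same value at \<open>t\<close> differ by a multiple
    of \<open>m\<close>, which vanishes at \<open>w\<close>; the choice made by \<open>SOME\<close>
    is therefore harmless.\<close>
  define \<psi> where "\<psi> x = pw (SOME p. ev p = x)" for x
  have \<psi>_ev: "\<psi> (ev p) = pw p" for p
    unfolding \<psi>_def by (rule pw_eq) (metis (mono_tags) someI_ex)
  have add: "\<psi> (x \<oplus> y) = \<psi> x + \<psi> y" and mult: "\<psi> (x \<otimes> y) = \<psi> x * \<psi> y"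
    if "x \<in> carrier R" "y \<in> carrier R" for x y
    using surj[OF that(1)] surj[OF that(2)]
    by (auto simp: \<psi>_ev pw_add pw_mult simp flip: ev_simps(4,5))
  have one: "\<psi> \<one> = 1" using \<psi>_ev[of 1] by (simp add: ev_simps pw_def map_poly_1)
  have zero: "\<psi> \<zero> = 0" using add[of \<zero> \<zero>] by (metis add_cancel_left_left l_zero zero_closed)
  have two': "z + z = 0" for z :: "bit alg_closure"
  proof -
    have "(1 :: bit alg_closure) + 1 = 0"
      by (metis add_self_mod_2 one one_closed two zero add)
    then show ?thesis by (metis distrib_right mult_1 mult_zero_left)
  qed
  have nz: "\<psi> x \<noteq> 0" if "x \<in> carrier R" "x \<noteq> \<zero>" for x
    using that mult[of x "inv x"] one by (auto simp: field_Units)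
  have inj: "inj_on \<psi> (carrier R)"
  proof (rule inj_onI)
    fix x y assume xy: "x \<in> carrier R" "y \<in> carrier R" "\<psi> x = \<psi> y"
    then have "\<psi> (x \<oplus> y) = 0" by (simp add: add two')
    then have "x \<oplus> y = \<zero>" using nz xy by (metis a_closed)
    then show "x = y" using xy neg by (metis minus_equality)
  qed
  have emb: "field_embedding R \<psi>"
    using add mult one inj by (simp add: field_embedding_def)
  let ?N = "card (carrier R)"
  have card1: "?N > 1"
    using fin one_not_zero by (metis card_le_Suc0_iff_eq less_Suc_eq_le linorder_not_less One_nat_def one_closed zero_closed)
  have pow: "\<psi> x ^ ?N = \<psi> x" if x: "x \<in> carrier R" for x
  proof (cases "x = \<zero>")
    case False
    interpret M: group "Multiplicative_Group.mult_of R" by (rule field_mult_group)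
    have "x [^]\<^bsub>Multiplicative_Group.mult_of R\<^esub> (?N - 1) = \<one>"
      using M.pow_order_eq_1[of x] False x fin by (simp add: Coset.order_def)
    then have "x [^] (?N - 1) = \<one>" by (simp add: Multiplicative_Group.nat_pow_mult_of)
    moreover have "\<psi> (x [^] i) = \<psi> x ^ i" for i :: nat
      using x by (induction i) (simp_all add: one mult)
    ultimately have "\<psi> x ^ (?N - 1) = 1" using one by metis
    then show ?thesis using card1 by (metis One_nat_def Suc_pred less_trans mult.right_neutral power_Suc zero_less_one)
  qed (use card1 zero in auto)
  \<comment> \<open>Every element of the image satisfies the equation, the equation has at most
    \<open>?N\<close> solutions, and by injectivity the image already has \<open>?N\<close>
    elements.\<close>
  have "\<psi> ` carrier R = {x. x ^ ?N = x}"
  proof (rule card_seteq)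
    show "card {x :: bit alg_closure. x ^ ?N = x} \<le> card (\<psi> ` carrier R)"
      using card_roots_of_power_eq_self(2)[OF card1, where 'r = "bit alg_closure"]
      by (simp add: card_image[OF inj])
  qed (use pow card_roots_of_power_eq_self(1)[OF card1] in auto)
  then show thesis using that emb by blast
qed


section \<open>Cardinality of a field extension\<close>

text \<open>Each step of the inductive predicate \<open>dimension\<close> adjoins a vector
  \<open>v\<close> outside V'. Then \<open>(k, u)\<close> is recovered from \<open>k v + u\<close>:
  two representations with different scalars would, after division by their difference, put
  \<open>v\<close> into V'.\<close>

lemma (in ring) card_dimension:
  assumes K: "subfield K R" and finK: "finite K" and dim: "dimension n K V"
  shows "finite V \<and> card V = card K ^ n"
  using dim
proof (induction n arbitrary: V)
  case 0
  then have "V = {\<zero>}" by (rule dimension_zero[OF K])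
  then show ?case by simp
next
  case (Suc n)
  interpret K: subfield K R by fact
  have KR: "K \<subseteq> carrier R" by (rule K.subset)
  obtain v V' where v: "v \<in> carrier R" "v \<notin> V'" "V = line_extension K v V'" and V': "dimension n K V'"
    using dimension_backwards[OF K Suc.prems] by auto
  note sub = space_subgroup_props[OF K V']
  have IH: "finite V'" "card V' = card K ^ n" using Suc.IH[OF V'] by auto
  let ?f = "\<lambda>(k, u). k \<otimes> v \<oplus> u"
  have eq: "V = ?f ` (K \<times> V')"
    by (auto simp: v(3) line_extension_mem_iff image_iff) blast
  have "inj_on ?f (K \<times> V')"
  proof (rule inj_onI)
    fix x y assume fxy: "?f x = ?f y" and "x \<in> K \<times> V'" "y \<in> K \<times> V'"
    from this(2,3) obtain k u l w where xy: "x = (k, u)" "y = (l, w)"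
      and mem: "k \<in> K" "l \<in> K" "u \<in> V'" "w \<in> V'" by auto
    have c: "k \<in> carrier R" "l \<in> carrier R" "u \<in> carrier R" "w \<in> carrier R"
      using mem KR sub(1) by auto
    have fkl: "k \<otimes> v \<oplus> u = l \<otimes> v \<oplus> w" using fxy by (simp only: xy case_prod_conv)
    have "(k \<ominus> l) \<otimes> v = (k \<otimes> v \<oplus> u) \<ominus> (l \<otimes> v \<oplus> u)"
      using c v(1) by algebra
    also have "\<dots> = w \<ominus> u" unfolding fkl using c v(1) by algebra
    finally have e: "(k \<ominus> l) \<otimes> v = w \<ominus> u" .
    have wu: "w \<ominus> u \<in> V'" using sub mem by (simp add: minus_eq)
    have kl: "k \<ominus> l \<in> K" using mem subringE(5,7)[OF subfieldE(1)[OF K]] by (simp add: minus_eq)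
    have "k \<ominus> l = \<zero>"
    proof (rule ccontr)
      assume "k \<ominus> l \<noteq> \<zero>"
      then have "v \<in> V'" using sub(6)[of "k \<ominus> l" v] kl v(1) wu e by simp
      then show False using v(2) by simp
    qed
    then have "k = l" using c by simp
    moreover from this have "u = w" using fkl c v(1) by simp
    ultimately show "x = y" by (simp add: xy)
  qed
  then show ?case
    using IH finK by (simp add: eq card_image card_cartesian_product)
qed

lemma card_field_extension:
  fixes F :: "('a, 'm) ring_scheme" and E :: "('b, 'n) ring_scheme"
  assumes "field F" "finite (carrier F)" "field_extension_of_degree F E d"
  shows "field E" "finite (carrier E)" "card (carrier E) = card (carrier F) ^ d"
    "\<one>\<^bsub>F\<^esub> \<oplus>\<^bsub>F\<^esub> \<one>\<^bsub>F\<^esub> = \<zero>\<^bsub>F\<^esub> \<Longrightarrow> \<one>\<^bsub>E\<^esub> \<oplus>\<^bsub>E\<^esub> \<one>\<^bsub>E\<^esub> = \<zero>\<^bsub>E\<^esub>"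
proof -
  obtain h where "field E" and h: "h \<in> ring_hom F E"
    and dim: "ring.dimension E d (h ` carrier F) (carrier E)"
    using assms(3) by (auto simp: field_extension_of_degree_def)
  interpret F: field F by fact
  interpret E: field E by fact
  interpret h: ring_hom_ring F E h using h by unfold_locales
  show "field E" by fact
  have K: "subfield (h ` carrier F) E"
    using h.img_is_subfield[OF F.carrier_is_subfield] E.one_not_zero by simp
  have inj: "inj_on h (carrier F)"
    using h.img_is_subfield(1)[OF F.carrier_is_subfield] E.one_not_zero by simp
  show "finite (carrier E)" "card (carrier E) = card (carrier F) ^ d"
    using E.card_dimension[OF K _ dim] assms(2) by (auto simp: card_image[OF inj])
  assume "\<one>\<^bsub>F\<^esub> \<oplus>\<^bsub>F\<^esub> \<one>\<^bsub>F\<^esub> = \<zero>\<^bsub>F\<^esub>"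
  then show "\<one>\<^bsub>E\<^esub> \<oplus>\<^bsub>E\<^esub> \<one>\<^bsub>E\<^esub> = \<zero>\<^bsub>E\<^esub>"
    by (metis F.one_closed h.hom_add h.hom_one h.hom_zero)
qed

section \<open>The dihedral group of order 12\<close>

definition gword_class :: "('s gword \<times> 's gword) set \<Rightarrow> 's gword \<Rightarrow> 's gword set" where
  "gword_class R u = {v. gword_eq R u v}"

lemma gword_eq_append:
  assumes "gword_eq R u v"
  shows "gword_eq R (a @ u @ b) (a @ v @ b)"
  using assms
proof (induction rule: gword_eq.induct)
  case (cancel u s b' v)
  show ?case using gword_eq.cancel[of R "a @ u" s b' "v @ b"] by simp
next
  case (relation l r u v)
  then show ?case using gword_eq.relation[of l r R "a @ u" "v @ b"] by simp
qed (auto intro: gword_eq.intros)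

lemma gword_eq_append2:
  assumes "gword_eq R u u'" "gword_eq R v v'"
  shows "gword_eq R (u @ v) (u' @ v')"
  using gword_eq_append[OF assms(1), of "[]" v] gword_eq_append[OF assms(2), of u' "[]"]
  by (auto intro: gword_eq.trans)

lemma gword_class_eq_iff: "gword_class R u = gword_class R v \<longleftrightarrow> gword_eq R u v"
  unfolding gword_class_def by (blast intro: gword_eq.refl gword_eq.sym gword_eq.trans)

lemma carrier_presented_group: "carrier (presented_group R) = range (gword_class R)"
  by (auto simp: presented_group_def gword_class_def quotient_def)

lemma one_presented_group: "\<one>\<^bsub>presented_group R\<^esub> = gword_class R []"
  by (simp add: presented_group_def gword_class_def)

lemma mult_presented_group:
  "gword_class R u \<otimes>\<^bsub>presented_group R\<^esub> gword_class R v = gword_class R (u @ v)"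
  unfolding presented_group_def gword_class_def
  by (auto intro: gword_eq.refl gword_eq.trans gword_eq_append2)

lemma group_presented_group: "group (presented_group R)"
proof (rule groupI)
  fix x assume "x \<in> carrier (presented_group R)"
  then obtain u where u: "x = gword_class R u" by (auto simp: carrier_presented_group)
  have "gword_eq R (map (\<lambda>(s, b). (s, \<not> b)) (rev u) @ u) []"
  proof (induction u)
    case (Cons l u)
    obtain s b where l: "l = (s, b)" by (cases l)
    have "gword_eq R (map (\<lambda>(s, b). (s, \<not> b)) (rev u) @ [(s, \<not> b), (s, \<not> \<not> b)] @ u)
        (map (\<lambda>(s, b). (s, \<not> b)) (rev u) @ u)"
      by (rule gword_eq.cancel)
    then show ?case using Cons by (auto simp: l intro: gword_eq.trans)
  qed (simp add: gword_eq.refl)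
  then show "\<exists>y\<in>carrier (presented_group R). y \<otimes>\<^bsub>presented_group R\<^esub> x = \<one>\<^bsub>presented_group R\<^esub>"
    by (auto simp: u carrier_presented_group mult_presented_group one_presented_group gword_class_eq_iff)
qed (auto simp: carrier_presented_group mult_presented_group one_presented_group)

text \<open>A code \<open>(b, g, p, q, r, s)\<close> records the parities \<open>b\<close> of \<open>y\<close> and \<open>g\<close> of \<open>x\<close> in a word, and
  the rows \<open>(p, q)\<close>, \<open>(r, s)\<close> of its image under \<open>D\<^sub>1\<^sub>2 \<rightarrow> S\<^sub>3 = GL\<^sub>2(F\<^sub>2)\<close>; it determines the
  group element.\<close>

type_synonym dihedral_code = "bit \<times> bit \<times> bit \<times> bit \<times> bit \<times> bit"

fun code_mult :: "dihedral_code \<Rightarrow> dihedral_code \<Rightarrow> dihedral_code" where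
  "code_mult (b, g, p, q, r, s) (b', g', p', q', r', s') =
     (b + b', g + g', p * p' + q * r', p * q' + q * s', r * p' + s * r', r * q' + s * s')"

definition code_one :: dihedral_code where
  "code_one = (0, 0, 1, 0, 0, 1)"

text \<open>\<open>x\<close> is sent to a matrix of order 3 together with an odd parity
  \<open>g\<close>, hence to something of order 6; \<open>y\<close> is sent to the swap matrix, an
  involution that inverts the matrix of \<open>x\<close>. The code of the inverse letter of
  \<open>x\<close> carries the inverse matrix, and \<open>y\<close> is its own inverse.\<close>

fun letter_code :: "dihedral_gen \<times> bool \<Rightarrow> dihedral_code" where
  "letter_code (Gen_x, True) = (0, 1, 1, 1, 1, 0)"
| "letter_code (Gen_x, False) = (0, 1, 0, 1, 1, 1)"
| "letter_code (Gen_y, _) = (1, 0, 0, 1, 1, 0)"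

definition word_code :: "dihedral_gen gword \<Rightarrow> dihedral_code" where
  "word_code w = foldr (\<lambda>l. code_mult (letter_code l)) w code_one"

lemma code_mult_assoc: "code_mult (code_mult t u) v = code_mult t (code_mult u v)"
  by (cases t; cases u; cases v) (simp add: algebra_simps del: add_bit_eq_xor mult_bit_eq_and)

lemma code_mult_one: "code_mult code_one t = t" "code_mult t code_one = t"
  by (cases t; simp add: code_one_def del: add_bit_eq_xor mult_bit_eq_and)+

lemma word_code_append: "word_code (u @ v) = code_mult (word_code u) (word_code v)"
  by (induction u) (simp_all add: word_code_def code_mult_one code_mult_assoc)

definition D12_relations :: "(dihedral_gen gword \<times> dihedral_gen gword) set" where
  "D12_relations = {(replicate 6 (Gen_x, True), []), (replicate 2 (Gen_y, True), []),
     ([(Gen_y, True), (Gen_x, True)], replicate 5 (Gen_x, True) @ [(Gen_y, True)])}"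

lemma D12_eq: "D12 = presented_group D12_relations"
  by (simp add: D12_def D12_relations_def Let_def)

text \<open>The codes satisfy the three defining relations, so words with different codes represent
  different elements. This is what bounds the presented group from below.\<close>

lemma word_code_cong: "gword_eq D12_relations u v \<Longrightarrow> word_code u = word_code v"
proof (induction rule: gword_eq.induct)
  case (cancel u s b v)
  have "word_code [(s, b), (s, \<not> b)] = code_one"
    by (cases s; cases b) (simp_all add: word_code_def code_one_def)
  then show ?case by (simp only: word_code_append code_mult_one)
next
  case (relation l r u v)
  then have "word_code l = word_code r"
    by (auto simp: D12_relations_def word_code_def code_one_def numeral_eq_Suc)
  then show ?case by (simp only: word_code_append)
qed auto

definition D12_code :: "dihedral_gen gword set \<Rightarrow> dihedral_code" where
  "D12_code A = word_code (SOME w. w \<in> A)"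

lemma D12_code_class: "D12_code (gword_class D12_relations w) = word_code w"
proof -
  have "w \<in> gword_class D12_relations w"
    by (simp add: gword_class_def gword_eq.refl)
  then have "(SOME v. v \<in> gword_class D12_relations w) \<in> gword_class D12_relations w"
    by (rule someI)
  then show ?thesis
    by (auto simp: D12_code_def gword_class_def dest: word_code_cong)
qed

lemma group_D12: "group D12"
  by (simp add: D12_eq group_presented_group)

lemma D12_code_mult:
  "A \<in> carrier D12 \<Longrightarrow> B \<in> carrier D12 \<Longrightarrow> D12_code (A \<otimes>\<^bsub>D12\<^esub> B) = code_mult (D12_code A) (D12_code B)"
  by (auto simp: D12_eq carrier_presented_group mult_presented_group D12_code_class word_code_append)

lemma D12_code_one: "D12_code \<one>\<^bsub>D12\<^esub> = code_one"
  by (simp add: D12_eq one_presented_group D12_code_class) (simp add: word_code_def)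

definition D12_elem :: "nat \<Rightarrow> nat \<Rightarrow> dihedral_gen gword set" where
  "D12_elem i j = gword_class D12_relations (replicate i (Gen_x, True) @ replicate j (Gen_y, True))"

lemma D12_code_elem:
  "D12_code (D12_elem i j) = word_code (replicate i (Gen_x, True) @ replicate j (Gen_y, True))"
  by (simp add: D12_elem_def D12_code_class)

text \<open>The upper bound. The set of normal forms contains the unit and is stable under left
  multiplication by each of the four letters, inverses included, so prepending letters to the empty
  word never leaves it.\<close>

lemma carrier_D12: "carrier D12 = (\<lambda>(i, j). D12_elem i j) ` ({..<6} \<times> {..<2})"
proof
  interpret group D12 by (rule group_D12)
  let ?c = "gword_class D12_relations"
  define gx where "gx = ?c [(Gen_x, True)]"
  define gy where "gy = ?c [(Gen_y, True)]"
  have c: "?c w \<in> carrier D12" for w by (auto simp: D12_eq carrier_presented_group)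
  have m: "?c u \<otimes>\<^bsub>D12\<^esub> ?c v = ?c (u @ v)" for u v by (simp add: D12_eq mult_presented_group)
  have c1: "\<one>\<^bsub>D12\<^esub> = ?c []" by (simp add: D12_eq one_presented_group)
  have XY: "gx \<in> carrier D12" "gy \<in> carrier D12" by (simp_all add: gx_def gy_def c)
  have Xi: "gx [^]\<^bsub>D12\<^esub> i = ?c (replicate i (Gen_x, True))" for i :: nat
    by (induction i) (simp_all add: m gx_def c1 flip: replicate_append_same)
  have Yi: "gy [^]\<^bsub>D12\<^esub> i = ?c (replicate i (Gen_y, True))" for i :: nat
    by (induction i) (simp_all add: m gy_def c1 flip: replicate_append_same)
  have elem: "D12_elem i j = gx [^]\<^bsub>D12\<^esub> i \<otimes>\<^bsub>D12\<^esub> gy [^]\<^bsub>D12\<^esub> j" for i j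
    by (simp add: Xi Yi m D12_elem_def)
  have rel: "?c l = ?c r" if "(l, r) \<in> D12_relations" for l r
    using gword_eq.relation[OF that, of "[]" "[]"] by (simp add: gword_class_eq_iff)
  have X6: "gx [^]\<^bsub>D12\<^esub> (6::nat) = \<one>\<^bsub>D12\<^esub>" and Y2: "gy [^]\<^bsub>D12\<^esub> (2::nat) = \<one>\<^bsub>D12\<^esub>"
    unfolding Xi Yi c1 by (rule rel, simp add: D12_relations_def)+
  have YX: "gy \<otimes>\<^bsub>D12\<^esub> gx = gx [^]\<^bsub>D12\<^esub> (5::nat) \<otimes>\<^bsub>D12\<^esub> gy"
    unfolding Xi unfolding gx_def gy_def m by (rule rel) (simp add: D12_relations_def)
  \<comment> \<open>Since 5 is -1 modulo 6, this is the rule that \<open>y\<close> inverts powers of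
    \<open>x\<close>, written with natural exponents.\<close>
  have YXi: "gy \<otimes>\<^bsub>D12\<^esub> gx [^]\<^bsub>D12\<^esub> i = gx [^]\<^bsub>D12\<^esub> (5 * i) \<otimes>\<^bsub>D12\<^esub> gy" for i :: nat
  proof (induction i)
    case (Suc i)
    have "gy \<otimes>\<^bsub>D12\<^esub> gx [^]\<^bsub>D12\<^esub> Suc i = (gy \<otimes>\<^bsub>D12\<^esub> gx [^]\<^bsub>D12\<^esub> i) \<otimes>\<^bsub>D12\<^esub> gx"
      using XY by (simp add: m_assoc)
    also have "\<dots> = gx [^]\<^bsub>D12\<^esub> (5 * i) \<otimes>\<^bsub>D12\<^esub> (gy \<otimes>\<^bsub>D12\<^esub> gx)"
      unfolding Suc using XY by (simp add: m_assoc)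
    also have "\<dots> = gx [^]\<^bsub>D12\<^esub> (5 * i + 5) \<otimes>\<^bsub>D12\<^esub> gy"
      unfolding YX using XY by (simp add: m_assoc flip: nat_pow_mult)
    finally show ?case by (simp add: add.commute)
  qed (use XY in simp)
  have pow_mod: "a [^]\<^bsub>D12\<^esub> (i mod k) = a [^]\<^bsub>D12\<^esub> i"
    if "a \<in> carrier D12" "a [^]\<^bsub>D12\<^esub> k = \<one>\<^bsub>D12\<^esub>" for a and i k :: nat
  proof -
    have "a [^]\<^bsub>D12\<^esub> i = a [^]\<^bsub>D12\<^esub> (k * (i div k)) \<otimes>\<^bsub>D12\<^esub> a [^]\<^bsub>D12\<^esub> (i mod k)"
      using that(1) by (simp add: nat_pow_mult)
    also have "a [^]\<^bsub>D12\<^esub> (k * (i div k)) = \<one>\<^bsub>D12\<^esub>"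
      using nat_pow_pow[OF that(1), of k "i div k"] by (simp add: that(2))
    finally show ?thesis using that(1) by simp
  qed
  note Xmod = pow_mod[OF XY(1) X6] and Ymod = pow_mod[OF XY(2) Y2]
  let ?N = "(\<lambda>(i, j). D12_elem i j) ` ({..<6} \<times> {..<2})"
  have N: "D12_elem i j \<in> ?N" for i j
    by (rule image_eqI[of _ _ "(i mod 6, j mod 2)"]) (simp_all add: elem Xmod Ymod)
  have XN: "gx \<otimes>\<^bsub>D12\<^esub> D12_elem i j \<in> ?N" for i j
  proof -
    have "gx \<otimes>\<^bsub>D12\<^esub> D12_elem i j = D12_elem (Suc i) j"
      unfolding elem nat_pow_Suc2[OF XY(1)] using XY by (simp add: m_assoc)
    then show ?thesis using N by simp
  qed
  have YN: "gy \<otimes>\<^bsub>D12\<^esub> D12_elem i j \<in> ?N" for i j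
  proof -
    have "gy \<otimes>\<^bsub>D12\<^esub> D12_elem i j = (gy \<otimes>\<^bsub>D12\<^esub> gx [^]\<^bsub>D12\<^esub> i) \<otimes>\<^bsub>D12\<^esub> gy [^]\<^bsub>D12\<^esub> j"
      using XY by (simp add: elem m_assoc)
    also have "\<dots> = D12_elem (5 * i) (Suc j)"
      unfolding YXi elem nat_pow_Suc2[OF XY(2)] using XY by (simp add: m_assoc)
    finally show ?thesis using N by simp
  qed
  have cancel: "?c [(s, False)] = inv\<^bsub>D12\<^esub> (?c [(s, True)])" for s
    using gword_eq.cancel[of D12_relations "[]" s False "[]"]
    by (intro inv_equality[symmetric]) (simp_all add: c m c1 gword_class_eq_iff)
  have Xinv: "inv\<^bsub>D12\<^esub> gx = gx [^]\<^bsub>D12\<^esub> (5::nat)"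
    using X6 XY by (intro inv_equality) (simp_all add: numeral_eq_Suc)
  have Yinv: "inv\<^bsub>D12\<^esub> gy = gy"
    using Y2 XY by (intro inv_equality) (simp_all add: numeral_eq_Suc)
  have letter: "?c [l] \<otimes>\<^bsub>D12\<^esub> A \<in> ?N" if AN: "A \<in> ?N" for l A
  proof -
    obtain s b where l: "l = (s, b)" by (cases l)
    obtain i j where A: "A = D12_elem i j" using AN by auto
    have "inv\<^bsub>D12\<^esub> gx \<otimes>\<^bsub>D12\<^esub> A \<in> ?N"
    proof -
      have "inv\<^bsub>D12\<^esub> gx \<otimes>\<^bsub>D12\<^esub> A = D12_elem (5 + i) j"
        using XY by (simp add: Xinv A elem m_assoc flip: nat_pow_mult)
      then show ?thesis using N by simp
    qed
    then show ?thesis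
      using XN YN Yinv by (cases s; cases b) (auto simp: l A cancel gx_def gy_def)
  qed
  show "carrier D12 \<subseteq> ?N"
  proof
    fix A assume "A \<in> carrier D12"
    then obtain w where A: "A = ?c w" by (auto simp: D12_eq carrier_presented_group)
    have "?c w \<in> ?N"
    proof (induction w)
      case Nil
      then show ?case using N[of 0 0] by (simp add: D12_elem_def)
    next
      case (Cons l w)
      then show ?case using letter[OF Cons, of l] by (simp add: m)
    qed
    then show "A \<in> ?N" by (simp add: A)
  qed
  show "?N \<subseteq> carrier D12" using XY by (auto simp: elem)
qed

lemma less_6_cases: "(i::nat) < 6 \<longleftrightarrow> i = 0 \<or> i = 1 \<or> i = 2 \<or> i = 3 \<or> i = 4 \<or> i = 5"
  by presburger

text \<open>The twelve normal forms have twelve different codes, checked case by case.\<close>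

lemma inj_on_D12_elem: "inj_on (\<lambda>(i, j). D12_elem i j) ({..<6} \<times> {..<2})"
proof (rule inj_onI, clarify)
  fix i j i' j'
  assume *: "i < (6::nat)" "j < (2::nat)" "i' < (6::nat)" "j' < (2::nat)" and "D12_elem i j = D12_elem i' j'"
  then have "D12_code (D12_elem i j) = D12_code (D12_elem i' j')" by simp
  then show "i = i' \<and> j = j'"
    using * unfolding D12_code_elem less_6_cases less_2_cases_iff
    by (elim disjE) (simp_all add: word_code_def code_one_def numeral_eq_Suc)
qed

lemma card_D12: "card (carrier D12) = 12" and finite_D12: "finite (carrier D12)"
  unfolding carrier_D12 by (simp_all add: card_image[OF inj_on_D12_elem])

lemma sum_D12: "(\<Sum>A\<in>carrier D12. f A) = (\<Sum>i<6. \<Sum>j<2. f (D12_elem i j))"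
  unfolding carrier_D12 by (simp add: sum.reindex[OF inj_on_D12_elem] sum.cartesian_product) (simp add: case_prod_unfold)

section \<open>The local model over one field\<close>

definition scalar_monoid :: "'r::comm_ring_1 set \<Rightarrow> 'r monoid" where
  "scalar_monoid K = \<lparr>carrier = K, monoid.mult = (*), one = 1\<rparr>"

type_synonym 'r quad = "'r \<times> 'r \<times> 'r \<times> 'r"

fun quad_matrix_mult :: "'r::comm_ring_1 quad \<Rightarrow> 'r quad \<Rightarrow> 'r quad" where
  "quad_matrix_mult (p, q, r, s) (p', q', r', s') =
     (p * p' + q * r', p * q' + q * s', r * p' + s * r', r * q' + s * s')"

fun quad_add :: "'r::comm_ring_1 quad \<Rightarrow> 'r quad \<Rightarrow> 'r quad" where
  "quad_add (p, q, r, s) (p', q', r', s') = (p + p', q + q', r + r', s + s')"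

text \<open>Multiplication in \<open>K[s, t] / (s\<^sup>2, t\<^sup>2)\<close> with respect to the basis \<open>1, s, t, st\<close>.\<close>

fun quad_local_mult :: "'r::comm_ring_1 quad \<Rightarrow> 'r quad \<Rightarrow> 'r quad" where
  "quad_local_mult (a, b, c, d) (a', b', c', d') =
     (a * a', a * b' + b * a', a * c' + c * a', a * d' + d * a' + b * c' + c * b')"

definition quads :: "'r set \<Rightarrow> 'r quad set" where
  "quads K = K \<times> K \<times> K \<times> K"

definition matrix_monoid :: "'r::comm_ring_1 set \<Rightarrow> 'r quad monoid" where
  "matrix_monoid K = \<lparr>carrier = quads K, monoid.mult = quad_matrix_mult, one = (1, 0, 0, 1)\<rparr>"

text \<open>A triple \<open>(l, P, Q)\<close> stands for the pair of \<open>l \<in> K[s, t] / (s\<^sup>2, t\<^sup>2)\<close> and the matrix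
  \<open>P + \<epsilon> Q\<close> over the dual numbers \<open>K[\<epsilon>] / (\<epsilon>\<^sup>2)\<close>.\<close>

definition block_monoid :: "'r::comm_ring_1 set \<Rightarrow> ('r quad \<times> 'r quad \<times> 'r quad) monoid" where
  "block_monoid K = \<lparr>carrier = quads K \<times> quads K \<times> quads K,
     monoid.mult = (\<lambda>(l, P, Q) (l', P', Q'). (quad_local_mult l l', quad_matrix_mult P P',
       quad_add (quad_matrix_mult P Q') (quad_matrix_mult Q P'))),
     one = ((1, 0, 0, 0), (1, 0, 0, 1), (0, 0, 0, 0))\<rparr>"

definition block_proj :: "'r quad \<times> 'r quad \<times> 'r quad \<Rightarrow> 'r \<times> 'r quad" where
  "block_proj = (\<lambda>(l, P, Q). (fst l, P))"

definition block_lift :: "'r::comm_ring_1 \<times> 'r quad \<Rightarrow> 'r quad \<times> 'r quad \<times> 'r quad" where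
  "block_lift = (\<lambda>(a, P). ((a, 0, 0, 0), P, (0, 0, 0, 0)))"

definition subring_set :: "'r::comm_ring_1 set \<Rightarrow> bool" where
  "subring_set K \<longleftrightarrow> 0 \<in> K \<and> 1 \<in> K \<and> (\<forall>x\<in>K. \<forall>y\<in>K. x + y \<in> K \<and> x * y \<in> K)"

abbreviation residue_monoid :: "'r::comm_ring_1 set \<Rightarrow> ('r \<times> 'r quad) monoid" where
  "residue_monoid K \<equiv> scalar_monoid K \<times>\<times> matrix_monoid K"

context
  fixes K :: "'r::comm_ring_1 set"
  assumes K: "subring_set K"
begin

lemma monoid_scalar_monoid: "monoid (scalar_monoid K)"
  using K by unfold_locales (auto simp: scalar_monoid_def subring_set_def ac_simps)

lemma monoid_matrix_monoid: "monoid (matrix_monoid K)"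
  using K by unfold_locales
    (auto simp: matrix_monoid_def subring_set_def quads_def algebra_simps)

lemma monoid_residue_monoid: "monoid (residue_monoid K)"
  by (intro DirProd_monoid monoid_scalar_monoid monoid_matrix_monoid)

lemma monoid_block_monoid: "monoid (block_monoid K)"
  using K by unfold_locales
    (auto simp: block_monoid_def subring_set_def quads_def algebra_simps)

lemma block_proj_hom: "block_proj \<in> hom (block_monoid K) (residue_monoid K)"
  using K by (auto simp: hom_def block_monoid_def block_proj_def scalar_monoid_def matrix_monoid_def
      quads_def subring_set_def)

lemma block_lift_hom: "block_lift \<in> hom (residue_monoid K) (block_monoid K)"
  using K by (auto simp: hom_def block_monoid_def block_lift_def scalar_monoid_def matrix_monoid_def
      quads_def subring_set_def)

end

lemma block_proj_one: "block_proj \<one>\<^bsub>block_monoid K\<^esub> = \<one>\<^bsub>residue_monoid K\<^esub>"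
  by (simp add: block_monoid_def block_proj_def scalar_monoid_def matrix_monoid_def)

lemma block_lift_one: "block_lift \<one>\<^bsub>residue_monoid K\<^esub> = \<one>\<^bsub>block_monoid K\<^esub>"
  by (simp add: block_monoid_def block_lift_def scalar_monoid_def matrix_monoid_def)

lemma block_proj_lift: "block_proj (block_lift h) = h"
  by (cases h) (simp add: block_proj_def block_lift_def)

lemma block_kernel_eq:
  assumes "subring_set K"
  shows "{v \<in> carrier (block_monoid K). block_proj v = \<one>\<^bsub>residue_monoid K\<^esub>} =
    (\<lambda>(t, Q). ((1, t), (1, 0, 0, 1), Q)) ` ((K \<times> K \<times> K) \<times> quads K)"
  using assms by (auto simp: block_monoid_def block_proj_def scalar_monoid_def matrix_monoid_def
      quads_def subring_set_def image_iff)

text \<open>The origin of the constant 7: of the 12 coordinates of a block, the retraction fixes one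
  local coordinate and four matrix entries. The three nilpotent local coordinates and the four
  entries of \<open>Q\<close> stay free.\<close>

lemma block_kernel_card:
  fixes K :: "'r::comm_ring_1 set"
  assumes "subring_set K"
  shows "card {v \<in> carrier (block_monoid K). block_proj v = \<one>\<^bsub>residue_monoid K\<^esub>} = card K ^ 7"
proof -
  have "inj_on (\<lambda>(t, Q). ((1 :: 'r, t), (1 :: 'r, 0 :: 'r, 0 :: 'r, 1 :: 'r), Q)) ((K \<times> K \<times> K) \<times> quads K)"
    by (auto simp: inj_on_def)
  then show ?thesis
    by (subst block_kernel_eq[OF assms])
      (simp add: card_image quads_def card_cartesian_product power_numeral_reduce ac_simps)
qed

text \<open>Kernel elements have the form \<open>1 + u\<close>. In the matrix part \<open>u\<close>
  is a multiple of \<epsilon>, and in the local part its square is \<open>2 b c\<close> times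
  \<open>s t\<close>; both squares vanish, and so does \<open>2 u\<close>.\<close>

lemma block_kernel_square:
  assumes "subring_set K" and two: "\<And>x :: 'r::comm_ring_1. x + x = 0"
    and v: "v \<in> carrier (block_monoid (K :: 'r set))" "block_proj v = \<one>\<^bsub>residue_monoid K\<^esub>"
  shows "v \<otimes>\<^bsub>block_monoid K\<^esub> v = \<one>\<^bsub>block_monoid K\<^esub>"
proof -
  obtain b c d p q r s where "v = ((1, b, c, d), (1, 0, 0, 1), (p, q, r, s))"
    using v by (cases v) (auto simp: block_proj_def scalar_monoid_def matrix_monoid_def)
  moreover have "d + d + b * c + c * b = 0"
    using two[of d] two[of "b * c"] by (simp add: mult.commute)
  ultimately show ?thesis
    using two by (simp add: block_monoid_def)
qed

lemma product_group_map_hom: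
  assumes "\<And>i. i \<in> I \<Longrightarrow> f i \<in> hom (M i) (N i)"
  shows "(\<lambda>x. \<lambda>i\<in>I. f i (x i)) \<in> hom (product_group I M) (product_group I N)"
  using assms by (auto simp: hom_def PiE_iff Pi_iff fun_eq_iff)

theorem iso_semidirect_product_blocks:
  fixes K :: "'i \<Rightarrow> 'r::comm_ring_1 set"
  assumes "finite J" and K: "\<And>j. j \<in> J \<Longrightarrow> subring_set (K j)"
    and two: "\<And>x :: 'r. x + x = 0"
    and card: "(\<Prod>j\<in>J. card (K j)) ^ 7 = 2 ^ m"
    and B: "group B" "units_of (product_group J (\<lambda>j. residue_monoid (K j))) \<cong> B"
  shows "iso_semidirect_product (units_of (product_group J (\<lambda>j. block_monoid (K j))))
    (direct_power (integer_mod_group 2) m) B"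
proof (rule iso_semidirect_product_units_of)
  let ?V = "product_group J (\<lambda>j. block_monoid (K j))"
  let ?H = "product_group J (\<lambda>j. residue_monoid (K j))"
  let ?p = "\<lambda>v. \<lambda>j\<in>J. block_proj (v j)" and ?s = "\<lambda>h. \<lambda>j\<in>J. block_lift (h j)"
  show "monoid ?V" "monoid ?H"
    by (intro monoid_product_group monoid_block_monoid monoid_residue_monoid K; assumption)+
  show "?p \<in> hom ?V ?H" "?s \<in> hom ?H ?V"
    by (intro product_group_map_hom block_proj_hom block_lift_hom K; assumption)+
  show "?p \<one>\<^bsub>?V\<^esub> = \<one>\<^bsub>?H\<^esub>" "?s \<one>\<^bsub>?H\<^esub> = \<one>\<^bsub>?V\<^esub>"
    by (auto simp: fun_eq_iff block_proj_one block_lift_one simp del: one_DirProd)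
  show "?p (?s h) = h" if "h \<in> carrier ?H" for h
    using that by (auto simp: fun_eq_iff block_proj_lift PiE_iff extensional_def)
  let ?ker = "\<lambda>j. {v \<in> carrier (block_monoid (K j)). block_proj v = \<one>\<^bsub>residue_monoid (K j)\<^esub>}"
  have p1: "?p v = \<one>\<^bsub>?H\<^esub> \<longleftrightarrow> (\<forall>j\<in>J. block_proj (v j) = \<one>\<^bsub>residue_monoid (K j)\<^esub>)" for v
    by (auto simp: fun_eq_iff restrict_def simp del: one_DirProd)
  show "v \<otimes>\<^bsub>?V\<^esub> v = \<one>\<^bsub>?V\<^esub>" if v: "v \<in> carrier ?V" "?p v = \<one>\<^bsub>?H\<^esub>" for v
  proof -
    have "v j \<otimes>\<^bsub>block_monoid (K j)\<^esub> v j = \<one>\<^bsub>block_monoid (K j)\<^esub>" if "j \<in> J" for j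
      using v(1) v(2)[unfolded p1] that
      by (intro block_kernel_square K two) (auto simp: PiE_iff simp del: one_DirProd)
    then show ?thesis by (auto simp: fun_eq_iff)
  qed
  have "{v \<in> carrier ?V. ?p v = \<one>\<^bsub>?H\<^esub>} = (\<Pi>\<^sub>E j\<in>J. ?ker j)"
    unfolding p1 by (auto simp: PiE_iff extensional_def simp del: one_DirProd)
  then have "card {v \<in> carrier ?V. ?p v = \<one>\<^bsub>?H\<^esub>} = (\<Prod>j\<in>J. card (?ker j))"
    using \<open>finite J\<close> by (simp add: card_PiE)
  also have "\<dots> = (\<Prod>j\<in>J. card (K j) ^ 7)"
    by (rule prod.cong[OF HOL.refl], rule block_kernel_card, rule K)
  also have "\<dots> = 2 ^ m" using card by (simp add: prod_power_distrib)
  finally show "card {v \<in> carrier ?V. ?p v = \<one>\<^bsub>?H\<^esub>} = 2 ^ m" .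
qed (rule B)+

section \<open>Frobenius powers on the algebraic closure\<close>

lemma char_2_add_self:
  fixes x :: "bit alg_closure"
  shows "x + x = 0"
proof -
  have "to_ac (1 + 1 :: bit) = 0" by simp
  then have "(1 :: bit alg_closure) + 1 = 0" unfolding to_ac_add by simp
  then show ?thesis by (metis distrib_right mult_1 mult_zero_left)
qed

lemma char_2_power_add:
  fixes x y :: "bit alg_closure"
  shows "(x + y) ^ 2 ^ m = x ^ 2 ^ m + y ^ 2 ^ m"
proof (induction m)
  case (Suc m)
  have "(x + y) ^ 2 ^ Suc m = ((x + y) ^ 2 ^ m)\<^sup>2"
    by (simp add: mult.commute flip: power_mult)
  also have "\<dots> = (x ^ 2 ^ m)\<^sup>2 + (y ^ 2 ^ m)\<^sup>2 + (x ^ 2 ^ m * y ^ 2 ^ m + x ^ 2 ^ m * y ^ 2 ^ m)"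
    unfolding Suc by (simp add: power2_eq_square algebra_simps)
  also have "\<dots> = x ^ 2 ^ Suc m + y ^ 2 ^ Suc m"
    by (simp only: char_2_add_self) (simp add: mult.commute flip: power_mult)
  finally show ?case .
qed simp

lemma char_2_power_sum:
  fixes f :: "'i \<Rightarrow> bit alg_closure"
  shows "(\<Sum>i\<in>A. f i) ^ 2 ^ m = (\<Sum>i\<in>A. f i ^ 2 ^ m)"
  by (induction A rule: infinite_finite_induct) (simp_all add: char_2_power_add)

text \<open>For \<open>N = 2 ^ m\<close> with \<open>m > 0\<close> this is the unique subfield with
  N elements; for \<open>m = 0\<close> it is the whole closure, so positivity of the exponent has to
  be known before elements are counted.\<close>

definition frobenius_fixed :: "nat \<Rightarrow> bit alg_closure set" where
  "frobenius_fixed N = {x. x ^ N = x}"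

lemma subring_set_frobenius_fixed: "subring_set (frobenius_fixed (2 ^ m))"
  by (simp add: subring_set_def frobenius_fixed_def char_2_power_add power_mult_distrib)

section \<open>The twelve coordinate functions on the dihedral group\<close>

definition code_b :: "dihedral_code \<Rightarrow> bit" where "code_b = (\<lambda>(b, g, p, q, r, s). b)"
definition code_g :: "dihedral_code \<Rightarrow> bit" where "code_g = (\<lambda>(b, g, p, q, r, s). g)"
definition code_p :: "dihedral_code \<Rightarrow> bit" where "code_p = (\<lambda>(b, g, p, q, r, s). p)"
definition code_q :: "dihedral_code \<Rightarrow> bit" where "code_q = (\<lambda>(b, g, p, q, r, s). q)"
definition code_r :: "dihedral_code \<Rightarrow> bit" where "code_r = (\<lambda>(b, g, p, q, r, s). r)"
definition code_s :: "dihedral_code \<Rightarrow> bit" where "code_s = (\<lambda>(b, g, p, q, r, s). s)"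

lemmas code_proj_defs = code_b_def code_g_def code_p_def code_q_def code_r_def code_s_def

lemma D12_code_table:
  "D12_code (D12_elem 0 0) = (0, 0, 1, 0, 0, 1)"
  "D12_code (D12_elem 0 1) = (1, 0, 0, 1, 1, 0)"
  "D12_code (D12_elem 1 0) = (0, 1, 1, 1, 1, 0)"
  "D12_code (D12_elem 1 1) = (1, 1, 1, 1, 0, 1)"
  "D12_code (D12_elem 2 0) = (0, 0, 0, 1, 1, 1)"
  "D12_code (D12_elem 2 1) = (1, 0, 1, 0, 1, 1)"
  "D12_code (D12_elem 3 0) = (0, 1, 1, 0, 0, 1)"
  "D12_code (D12_elem 3 1) = (1, 1, 0, 1, 1, 0)"
  "D12_code (D12_elem 4 0) = (0, 0, 1, 1, 1, 0)"
  "D12_code (D12_elem 4 1) = (1, 0, 1, 1, 0, 1)"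
  "D12_code (D12_elem 5 0) = (0, 1, 0, 1, 1, 1)"
  "D12_code (D12_elem 5 1) = (1, 1, 1, 0, 1, 1)"
  by (simp_all add: D12_code_elem word_code_def code_one_def numeral_eq_Suc)

lemma sum_D12_expand:
  fixes f :: "_ \<Rightarrow> bit alg_closure"
  shows "(\<Sum>A\<in>carrier D12. f A) =
    f (D12_elem 0 0) + f (D12_elem 0 1) + f (D12_elem 1 0) + f (D12_elem 1 1) +
    f (D12_elem 2 0) + f (D12_elem 2 1) + f (D12_elem 3 0) + f (D12_elem 3 1) +
    f (D12_elem 4 0) + f (D12_elem 4 1) + f (D12_elem 5 0) + f (D12_elem 5 1)"
  unfolding sum_D12 by (simp add: eval_nat_numeral lessThan_Suc add_ac)

text \<open>The indicator function of every group element is a sum of some of the twelve functions,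
  so pairing \<open>f\<close> with such a sum isolates one value of \<open>f\<close>.\<close>

lemma D12_code_functions_independent:
  fixes f :: "_ \<Rightarrow> bit alg_closure"
  defines "T \<equiv> \<lambda>\<kappa>. \<Sum>A\<in>carrier D12. f A * to_ac (\<kappa> (D12_code A))"
  assumes T: "T (\<lambda>_. 1) = 0" "T code_b = 0" "T code_g = 0" "T (\<lambda>t. code_b t * code_g t) = 0"
    "T code_p = 0" "T code_q = 0" "T code_r = 0" "T code_s = 0"
    "T (\<lambda>t. code_g t * code_p t) = 0" "T (\<lambda>t. code_g t * code_q t) = 0"
    "T (\<lambda>t. code_g t * code_r t) = 0" "T (\<lambda>t. code_g t * code_s t) = 0"
    and A: "A \<in> carrier D12"
  shows "f A = 0"
proof -
  have T_add: "T (\<lambda>t. \<kappa> t + \<kappa>' t) = T \<kappa> + T \<kappa>'" for \<kappa> \<kappa>'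
    unfolding T_def to_ac_add by (simp add: distrib_left sum.distrib del: to_ac_add)
  \<comment> \<open>This function factors as \<open>(1 + g) (1 + b + p + s)\<close>, which is 1 at
    the identity only. All twelve sums have the form \<open>(1 + g) h\<close> or \<open>g h\<close>:
    the first factor fixes the parity of the power of \<open>x\<close>, and \<open>h\<close>, affine
    in \<open>b, p, q, r, s\<close>, singles out one element of the quotient of order 6.\<close>
  have "T (\<lambda>t. 1 + code_b t + code_g t + code_b t * code_g t + code_p t + code_s t + code_g t * code_p t + code_g t * code_s t) = f (D12_elem 0 0)"
    by (simp add: T_def sum_D12_expand D12_code_table code_proj_defs del: One_nat_def)
  moreover have "T (\<lambda>t. 1 + code_b t + code_g t + code_b t * code_g t + code_p t + code_s t + code_g t * code_p t + code_g t * code_s t) = 0"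
    by (simp only: T_add T add_0)
  ultimately have e00: "f (D12_elem 0 0) = 0" by simp
  have "T (\<lambda>t. code_b t + code_b t * code_g t + code_q t + code_r t + code_g t * code_q t + code_g t * code_r t) = f (D12_elem 0 1)"
    by (simp add: T_def sum_D12_expand D12_code_table code_proj_defs del: One_nat_def)
  moreover have "T (\<lambda>t. code_b t + code_b t * code_g t + code_q t + code_r t + code_g t * code_q t + code_g t * code_r t) = 0"
    by (simp only: T_add T add_0)
  ultimately have e01: "f (D12_elem 0 1) = 0" by simp
  have "T (\<lambda>t. code_g t + code_b t * code_g t + code_g t * code_q t + code_g t * code_r t + code_g t * code_s t) = f (D12_elem 1 0)"
    by (simp add: T_def sum_D12_expand D12_code_table code_proj_defs del: One_nat_def)
  moreover have "T (\<lambda>t. code_g t + code_b t * code_g t + code_g t * code_q t + code_g t * code_r t + code_g t * code_s t) = 0"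
    by (simp only: T_add T add_0)
  ultimately have e10: "f (D12_elem 1 0) = 0" by simp
  have "T (\<lambda>t. code_b t * code_g t + code_g t * code_p t + code_g t * code_r t + code_g t * code_s t) = f (D12_elem 1 1)"
    by (simp add: T_def sum_D12_expand D12_code_table code_proj_defs del: One_nat_def)
  moreover have "T (\<lambda>t. code_b t * code_g t + code_g t * code_p t + code_g t * code_r t + code_g t * code_s t) = 0"
    by (simp only: T_add T add_0)
  ultimately have e11: "f (D12_elem 1 1) = 0" by simp
  have "T (\<lambda>t. 1 + code_b t + code_g t + code_b t * code_g t + code_p t + code_q t + code_r t + code_g t * code_p t + code_g t * code_q t + code_g t * code_r t) = f (D12_elem 2 0)"
    by (simp add: T_def sum_D12_expand D12_code_table code_proj_defs del: One_nat_def)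
  moreover have "T (\<lambda>t. 1 + code_b t + code_g t + code_b t * code_g t + code_p t + code_q t + code_r t + code_g t * code_p t + code_g t * code_q t + code_g t * code_r t) = 0"
    by (simp only: T_add T add_0)
  ultimately have e20: "f (D12_elem 2 0) = 0" by simp
  have "T (\<lambda>t. code_b t + code_b t * code_g t + code_p t + code_q t + code_s t + code_g t * code_p t + code_g t * code_q t + code_g t * code_s t) = f (D12_elem 2 1)"
    by (simp add: T_def sum_D12_expand D12_code_table code_proj_defs del: One_nat_def)
  moreover have "T (\<lambda>t. code_b t + code_b t * code_g t + code_p t + code_q t + code_s t + code_g t * code_p t + code_g t * code_q t + code_g t * code_s t) = 0"
    by (simp only: T_add T add_0)
  ultimately have e21: "f (D12_elem 2 1) = 0" by simp
  have "T (\<lambda>t. code_g t + code_b t * code_g t + code_g t * code_p t + code_g t * code_s t) = f (D12_elem 3 0)"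
    by (simp add: T_def sum_D12_expand D12_code_table code_proj_defs del: One_nat_def)
  moreover have "T (\<lambda>t. code_g t + code_b t * code_g t + code_g t * code_p t + code_g t * code_s t) = 0"
    by (simp only: T_add T add_0)
  ultimately have e30: "f (D12_elem 3 0) = 0" by simp
  have "T (\<lambda>t. code_b t * code_g t + code_g t * code_q t + code_g t * code_r t) = f (D12_elem 3 1)"
    by (simp add: T_def sum_D12_expand D12_code_table code_proj_defs del: One_nat_def)
  moreover have "T (\<lambda>t. code_b t * code_g t + code_g t * code_q t + code_g t * code_r t) = 0"
    by (simp only: T_add T add_0)
  ultimately have e31: "f (D12_elem 3 1) = 0" by simp
  have "T (\<lambda>t. 1 + code_b t + code_g t + code_b t * code_g t + code_q t + code_r t + code_s t + code_g t * code_q t + code_g t * code_r t + code_g t * code_s t) = f (D12_elem 4 0)"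
    by (simp add: T_def sum_D12_expand D12_code_table code_proj_defs del: One_nat_def)
  moreover have "T (\<lambda>t. 1 + code_b t + code_g t + code_b t * code_g t + code_q t + code_r t + code_s t + code_g t * code_q t + code_g t * code_r t + code_g t * code_s t) = 0"
    by (simp only: T_add T add_0)
  ultimately have e40: "f (D12_elem 4 0) = 0" by simp
  have "T (\<lambda>t. code_b t + code_b t * code_g t + code_p t + code_r t + code_s t + code_g t * code_p t + code_g t * code_r t + code_g t * code_s t) = f (D12_elem 4 1)"
    by (simp add: T_def sum_D12_expand D12_code_table code_proj_defs del: One_nat_def)
  moreover have "T (\<lambda>t. code_b t + code_b t * code_g t + code_p t + code_r t + code_s t + code_g t * code_p t + code_g t * code_r t + code_g t * code_s t) = 0"
    by (simp only: T_add T add_0)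
  ultimately have e41: "f (D12_elem 4 1) = 0" by simp
  have "T (\<lambda>t. code_g t + code_b t * code_g t + code_g t * code_p t + code_g t * code_q t + code_g t * code_r t) = f (D12_elem 5 0)"
    by (simp add: T_def sum_D12_expand D12_code_table code_proj_defs del: One_nat_def)
  moreover have "T (\<lambda>t. code_g t + code_b t * code_g t + code_g t * code_p t + code_g t * code_q t + code_g t * code_r t) = 0"
    by (simp only: T_add T add_0)
  ultimately have e50: "f (D12_elem 5 0) = 0" by simp
  have "T (\<lambda>t. code_b t * code_g t + code_g t * code_p t + code_g t * code_q t + code_g t * code_s t) = f (D12_elem 5 1)"
    by (simp add: T_def sum_D12_expand D12_code_table code_proj_defs del: One_nat_def)
  moreover have "T (\<lambda>t. code_b t * code_g t + code_g t * code_p t + code_g t * code_q t + code_g t * code_s t) = 0"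
    by (simp only: T_add T add_0)
  ultimately have e51: "f (D12_elem 5 1) = 0" by simp
  from A obtain i j where "A = D12_elem i j" "i < 6" "j < 2" by (auto simp: carrier_D12)
  then show ?thesis
    using e00 e01 e10 e11 e20 e21 e30 e31 e40 e41 e50 e51
    unfolding less_6_cases less_2_cases_iff by (elim disjE) simp_all
qed

section \<open>Evaluation of the group algebra\<close>

text \<open>Linear extension of a function \<open>c\<close> on the group to the group algebra; every
  coordinate of the evaluation map is a functional of this shape.\<close>

definition weighted_sum ::
    "('a \<Rightarrow> 'r::field) \<Rightarrow> ('g, 'n) monoid_scheme \<Rightarrow> ('g \<Rightarrow> 'r) \<Rightarrow> ('g \<Rightarrow> 'a) \<Rightarrow> 'r" where
  "weighted_sum \<psi> G c f = (\<Sum>g\<in>carrier G. \<psi> (f g) * c g)"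

context
  fixes R :: "('a, 'm) ring_scheme" and G :: "('g, 'n) monoid_scheme" and \<psi> :: "'a \<Rightarrow> 'r::field"
  assumes ring: "ring R" and group: "group G" and fin: "finite (carrier G)"
    and emb: "field_embedding R \<psi>"
begin

interpretation ring R by (rule ring)
interpretation G: group G by (rule group)

lemma carrier_group_algebra: "carrier (group_algebra R G) = (carrier G \<rightarrow>\<^sub>E carrier R)"
  using fin by (auto simp: group_algebra_def)

lemma group_algebra_mult_closed:
  assumes "f \<in> carrier (group_algebra R G)" "h \<in> carrier (group_algebra R G)"
  shows "f \<otimes>\<^bsub>group_algebra R G\<^esub> h \<in> carrier (group_algebra R G)"
proof -
  have "f x \<in> carrier R" "h x \<in> carrier R" if "x \<in> carrier G" for x
    using assms that by (auto simp: carrier_group_algebra PiE_iff)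
  then show ?thesis
    unfolding carrier_group_algebra
    by (auto simp: group_algebra_def intro!: finsum_closed)
qed

lemma group_algebra_one_closed: "\<one>\<^bsub>group_algebra R G\<^esub> \<in> carrier (group_algebra R G)"
  unfolding carrier_group_algebra by (auto simp: group_algebra_def)

lemma group_algebra_mult_embedding:
  assumes f: "f \<in> carrier (group_algebra R G)" and h: "h \<in> carrier (group_algebra R G)"
    and g: "g \<in> carrier G"
  shows "\<psi> ((f \<otimes>\<^bsub>group_algebra R G\<^esub> h) g) =
    (\<Sum>x\<in>carrier G. \<psi> (f x) * \<psi> (h (inv\<^bsub>G\<^esub> x \<otimes>\<^bsub>G\<^esub> g)))"
proof -
  have c: "f x \<in> carrier R" "h x \<in> carrier R" if "x \<in> carrier G" for x
    using f h that by (auto simp: carrier_group_algebra PiE_iff)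
  let ?S = "{x \<in> carrier G. f x \<noteq> \<zero>\<^bsub>R\<^esub>}"
  have "\<psi> ((f \<otimes>\<^bsub>group_algebra R G\<^esub> h) g) = \<psi> (\<Oplus>\<^bsub>R\<^esub>x\<in>?S. f x \<otimes>\<^bsub>R\<^esub> h (inv\<^bsub>G\<^esub> x \<otimes>\<^bsub>G\<^esub> g))"
    using g by (simp add: group_algebra_def)
  also have "\<dots> = (\<Sum>x\<in>?S. \<psi> (f x \<otimes>\<^bsub>R\<^esub> h (inv\<^bsub>G\<^esub> x \<otimes>\<^bsub>G\<^esub> g)))"
    using c g fin by (intro field_embedding_finsum[OF ring emb]) auto
  also have "\<dots> = (\<Sum>x\<in>?S. \<psi> (f x) * \<psi> (h (inv\<^bsub>G\<^esub> x \<otimes>\<^bsub>G\<^esub> g)))"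
    using c g by (intro sum.cong) (auto simp: field_embedding_mult[OF ring emb])
  also have "\<dots> = (\<Sum>x\<in>carrier G. \<psi> (f x) * \<psi> (h (inv\<^bsub>G\<^esub> x \<otimes>\<^bsub>G\<^esub> g)))"
    using fin by (intro sum.mono_neutral_left) (auto simp: field_embedding_zero[OF ring emb])
  finally show ?thesis .
qed

lemma weighted_sum_mult:
  assumes f: "f \<in> carrier (group_algebra R G)" and h: "h \<in> carrier (group_algebra R G)"
  shows "weighted_sum \<psi> G c (f \<otimes>\<^bsub>group_algebra R G\<^esub> h) =
    (\<Sum>x\<in>carrier G. \<Sum>y\<in>carrier G. \<psi> (f x) * \<psi> (h y) * c (x \<otimes>\<^bsub>G\<^esub> y))"
proof -
  have "weighted_sum \<psi> G c (f \<otimes>\<^bsub>group_algebra R G\<^esub> h) =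
      (\<Sum>g\<in>carrier G. \<Sum>x\<in>carrier G. \<psi> (f x) * \<psi> (h (inv\<^bsub>G\<^esub> x \<otimes>\<^bsub>G\<^esub> g)) * c g)"
    unfolding weighted_sum_def
    by (intro sum.cong) (simp_all add: group_algebra_mult_embedding[OF f h] sum_distrib_right)
  also have "\<dots> = (\<Sum>x\<in>carrier G. \<Sum>g\<in>carrier G. \<psi> (f x) * \<psi> (h (inv\<^bsub>G\<^esub> x \<otimes>\<^bsub>G\<^esub> g)) * c g)"
    by (rule sum.swap)
  also have "\<dots> = (\<Sum>x\<in>carrier G. \<Sum>y\<in>carrier G. \<psi> (f x) * \<psi> (h y) * c (x \<otimes>\<^bsub>G\<^esub> y))"
  proof (rule sum.cong)
    fix x assume x: "x \<in> carrier G"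
    show "(\<Sum>g\<in>carrier G. \<psi> (f x) * \<psi> (h (inv\<^bsub>G\<^esub> x \<otimes>\<^bsub>G\<^esub> g)) * c g) =
        (\<Sum>y\<in>carrier G. \<psi> (f x) * \<psi> (h y) * c (x \<otimes>\<^bsub>G\<^esub> y))"
      by (rule sum.reindex_bij_witness[of _ "\<lambda>y. x \<otimes>\<^bsub>G\<^esub> y" "\<lambda>g. inv\<^bsub>G\<^esub> x \<otimes>\<^bsub>G\<^esub> g"])
        (use x in \<open>auto simp flip: G.m_assoc\<close>)
  qed simp
  finally show ?thesis .
qed

text \<open>The list L records how \<open>c\<close> decomposes on products, as for a matrix
  coefficient of a representation. By bilinearity the same decomposition governs the functional of
  \<open>c\<close> on products in the group algebra.\<close>

lemma weighted_sum_mult_list: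
  assumes f: "f \<in> carrier (group_algebra R G)" and h: "h \<in> carrier (group_algebra R G)"
    and c: "\<And>x y. x \<in> carrier G \<Longrightarrow> y \<in> carrier G \<Longrightarrow> c (x \<otimes>\<^bsub>G\<^esub> y) = (\<Sum>(a, b)\<leftarrow>L. a x * b y)"
  shows "weighted_sum \<psi> G c (f \<otimes>\<^bsub>group_algebra R G\<^esub> h) =
    (\<Sum>(a, b)\<leftarrow>L. weighted_sum \<psi> G a f * weighted_sum \<psi> G b h)"
proof -
  have "(\<Sum>x\<in>carrier G. \<Sum>y\<in>carrier G. \<psi> (f x) * \<psi> (h y) * (\<Sum>(a, b)\<leftarrow>L. a x * b y)) =
      (\<Sum>(a, b)\<leftarrow>L. weighted_sum \<psi> G a f * weighted_sum \<psi> G b h)"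
  proof (induction L)
    case (Cons ab L)
    obtain a b where ab: "ab = (a, b)" by (cases ab)
    have "(\<Sum>x\<in>carrier G. \<Sum>y\<in>carrier G. \<psi> (f x) * \<psi> (h y) * (a x * b y)) =
        weighted_sum \<psi> G a f * weighted_sum \<psi> G b h"
      unfolding weighted_sum_def sum_product by (simp add: mult_ac)
    then show ?case
      using Cons by (simp add: ab distrib_left sum.distrib)
  qed simp
  then show ?thesis
    unfolding weighted_sum_mult[OF f h] using c by simp
qed

lemma weighted_sum_one: "weighted_sum \<psi> G c \<one>\<^bsub>group_algebra R G\<^esub> = c \<one>\<^bsub>G\<^esub>"
proof -
  have "weighted_sum \<psi> G c \<one>\<^bsub>group_algebra R G\<^esub> = (\<Sum>g\<in>carrier G. if g = \<one>\<^bsub>G\<^esub> then c g else 0)"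
    unfolding weighted_sum_def
    by (intro sum.cong) (auto simp: group_algebra_def field_embedding_zero[OF ring emb] field_embedding_one[OF ring emb])
  also have "\<dots> = c \<one>\<^bsub>G\<^esub>" using fin by simp
  finally show ?thesis .
qed

end

definition cyclic_times_D12 :: "nat \<Rightarrow> (int \<times> dihedral_gen gword set) monoid" where
  "cyclic_times_D12 n = integer_mod_group n \<times>\<times> D12"

lemma group_cyclic_times_D12: "group (cyclic_times_D12 n)"
  by (simp add: cyclic_times_D12_def DirProd_group group_D12)

lemma carrier_cyclic_times_D12: "n > 0 \<Longrightarrow> carrier (cyclic_times_D12 n) = {0..<int n} \<times> carrier D12"
  by (simp add: cyclic_times_D12_def carrier_integer_mod_group)

lemma finite_cyclic_times_D12: "n > 0 \<Longrightarrow> finite (carrier (cyclic_times_D12 n))"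
  by (simp add: carrier_cyclic_times_D12 finite_D12)

lemma card_cyclic_times_D12: "n > 0 \<Longrightarrow> card (carrier (cyclic_times_D12 n)) = 12 * n"
  by (simp add: carrier_cyclic_times_D12 card_D12 card_cartesian_product)

definition code_weight ::
    "bit alg_closure \<Rightarrow> (dihedral_code \<Rightarrow> bit) \<Rightarrow> int \<times> dihedral_gen gword set \<Rightarrow> bit alg_closure" where
  "code_weight z \<kappa> = (\<lambda>(i, A). z ^ nat i * to_ac (\<kappa> (D12_code A)))"

definition code_sum ::
    "('a \<Rightarrow> bit alg_closure) \<Rightarrow> nat \<Rightarrow> bit alg_closure \<Rightarrow> (int \<times> dihedral_gen gword set \<Rightarrow> 'a) \<Rightarrow>
      (dihedral_code \<Rightarrow> bit) \<Rightarrow> bit alg_closure" where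
  "code_sum \<psi> n z f \<kappa> = weighted_sum \<psi> (cyclic_times_D12 n) (code_weight z \<kappa>) f"

text \<open>In characteristic 2 the maps \<open>y \<mapsto> 1 + s\<close>, \<open>x \<mapsto> 1 + t\<close> and \<open>g \<mapsto> (1 + \<gamma>(g) \<epsilon>) \<rho>(g)\<close> are
  multiplicative, where \<open>\<gamma>\<close> is the second and \<open>\<rho>\<close> the matrix component of the code.\<close>

definition block_coords ::
    "('a \<Rightarrow> bit alg_closure) \<Rightarrow> nat \<Rightarrow> bit alg_closure \<Rightarrow> (int \<times> dihedral_gen gword set \<Rightarrow> 'a) \<Rightarrow>
      bit alg_closure quad \<times> bit alg_closure quad \<times> bit alg_closure quad" where
  "block_coords \<psi> n z f = (let S = code_sum \<psi> n z f in
     ((S (\<lambda>_. 1), S code_b, S code_g, S (\<lambda>t. code_b t * code_g t)),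
      (S code_p, S code_q, S code_r, S code_s),
      (S (\<lambda>t. code_g t * code_p t), S (\<lambda>t. code_g t * code_q t),
       S (\<lambda>t. code_g t * code_r t), S (\<lambda>t. code_g t * code_s t))))"

lemma power_nat_mod:
  fixes z :: "'r::comm_ring_1"
  assumes "z ^ n = 1" "i \<in> {0..<int n}" "j \<in> {0..<int n}"
  shows "z ^ nat ((i + j) mod int n) = z ^ nat i * z ^ nat j"
proof -
  have "nat ((i + j) mod int n) = (nat i + nat j) mod n"
    using assms by (simp add: nat_mod_distrib nat_add_distrib)
  moreover have "z ^ m = z ^ (m mod n)" for m
  proof -
    have "z ^ m = z ^ (n * (m div n) + m mod n)" by simp
    also have "\<dots> = z ^ (m mod n)" unfolding power_add power_mult by (simp add: assms(1))
    finally show ?thesis .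
  qed
  ultimately show ?thesis by (metis power_add)
qed

context
  fixes R :: "('a, 'm) ring_scheme" and \<psi> :: "'a \<Rightarrow> bit alg_closure" and n :: nat
  assumes ring: "ring R" and emb: "field_embedding R \<psi>" and n: "n > 0"
begin

abbreviation "GA \<equiv> group_algebra R (cyclic_times_D12 n)"

text \<open>The power of \<open>z\<close> is a character of the cyclic factor, as
  \<open>z ^ n = 1\<close> absorbs the reduction of exponents modulo n. It splits multiplicatively,
  so the product rule of \<kappa> carries over unchanged.\<close>

lemma code_sum_mult:
  assumes f: "f \<in> carrier GA" and h: "h \<in> carrier GA" and z: "z ^ n = 1"
    and \<kappa>: "\<And>t u. \<kappa> (code_mult t u) = (\<Sum>(a, b)\<leftarrow>L. a t * b u)"
  shows "code_sum \<psi> n z (f \<otimes>\<^bsub>GA\<^esub> h) \<kappa> = (\<Sum>(a, b)\<leftarrow>L. code_sum \<psi> n z f a * code_sum \<psi> n z h b)"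
proof -
  let ?L = "map (\<lambda>(a, b). (code_weight z a, code_weight z b)) L"
  have "weighted_sum \<psi> (cyclic_times_D12 n) (code_weight z \<kappa>) (f \<otimes>\<^bsub>GA\<^esub> h) =
      (\<Sum>(a, b)\<leftarrow>?L. weighted_sum \<psi> (cyclic_times_D12 n) a f * weighted_sum \<psi> (cyclic_times_D12 n) b h)"
  proof (rule weighted_sum_mult_list[OF ring group_cyclic_times_D12 finite_cyclic_times_D12[OF n] emb f h])
    fix x y assume "x \<in> carrier (cyclic_times_D12 n)" "y \<in> carrier (cyclic_times_D12 n)"
    then obtain i A j B where x: "x = (i, A)" and y: "y = (j, B)"
      and ij: "i \<in> {0..<int n}" "j \<in> {0..<int n}" and AB: "A \<in> carrier D12" "B \<in> carrier D12"
      using n by (auto simp: carrier_cyclic_times_D12)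
    have "code_weight z \<kappa> (x \<otimes>\<^bsub>cyclic_times_D12 n\<^esub> y) =
        z ^ nat ((i + j) mod int n) * to_ac (\<kappa> (D12_code (A \<otimes>\<^bsub>D12\<^esub> B)))"
      by (simp add: x y code_weight_def cyclic_times_D12_def)
    also have "\<dots> = z ^ nat i * z ^ nat j * to_ac (\<Sum>(a, b)\<leftarrow>L. a (D12_code A) * b (D12_code B))"
      by (simp only: power_nat_mod[OF z ij] D12_code_mult[OF AB] \<kappa>)
    also have "\<dots> = (\<Sum>(a, b)\<leftarrow>?L. a x * b y)"
    proof (induction L)
      case (Cons ab L)
      then show ?case
        by (cases ab) (simp add: distrib_left code_weight_def x y mult_ac del: add_bit_eq_xor mult_bit_eq_and)
    qed simp
    finally show "code_weight z \<kappa> (x \<otimes>\<^bsub>cyclic_times_D12 n\<^esub> y) = (\<Sum>(a, b)\<leftarrow>?L. a x * b y)" .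
  qed
  also have "\<dots> = (\<Sum>(a, b)\<leftarrow>L. code_sum \<psi> n z f a * code_sum \<psi> n z h b)"
    by (simp add: code_sum_def comp_def case_prod_unfold)
  finally show ?thesis by (simp add: code_sum_def)
qed

lemma block_coords_mult:
  assumes f: "f \<in> carrier GA" and h: "h \<in> carrier GA" and z: "z ^ n = 1"
  shows "block_coords \<psi> n z (f \<otimes>\<^bsub>GA\<^esub> h) =
    block_coords \<psi> n z f \<otimes>\<^bsub>block_monoid K\<^esub> block_coords \<psi> n z h"
proof -
  note S = code_sum_mult[OF f h z]
  let ?bg = "\<lambda>t. code_b t * code_g t" and ?u = "\<lambda>_. 1"
  let ?gp = "\<lambda>t. code_g t * code_p t" and ?gq = "\<lambda>t. code_g t * code_q t"
  let ?gr = "\<lambda>t. code_g t * code_r t" and ?gs = "\<lambda>t. code_g t * code_s t"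
  \<comment> \<open>The product rules of the twelve functions. For the last four,
    \<open>(g + g') (p p' + q r')\<close> and its analogues are expanded into four terms, which is
    the product rule for the coefficient of \<epsilon>.\<close>
  define M where "M = {(?u, [(?u, ?u)]), (code_b, [(?u, code_b), (code_b, ?u)]),
      (code_g, [(?u, code_g), (code_g, ?u)]),
      (?bg, [(?u, ?bg), (?bg, ?u), (code_b, code_g), (code_g, code_b)]),
      (code_p, [(code_p, code_p), (code_q, code_r)]), (code_q, [(code_p, code_q), (code_q, code_s)]),
      (code_r, [(code_r, code_p), (code_s, code_r)]), (code_s, [(code_r, code_q), (code_s, code_s)]),
      (?gp, [(code_p, ?gp), (code_q, ?gr), (?gp, code_p), (?gq, code_r)]),
      (?gq, [(code_p, ?gq), (code_q, ?gs), (?gp, code_q), (?gq, code_s)]),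
      (?gr, [(code_r, ?gp), (code_s, ?gr), (?gr, code_p), (?gs, code_r)]),
      (?gs, [(code_r, ?gq), (code_s, ?gs), (?gr, code_q), (?gs, code_s)])}"
  have 1: "\<kappa> (code_mult t u) = (\<Sum>(a, b)\<leftarrow>L. a t * b u)" if "(\<kappa>, L) \<in> M" for \<kappa> L t u
    using that unfolding M_def by (cases t; cases u)
      (auto simp: code_proj_defs algebra_simps simp del: add_bit_eq_xor mult_bit_eq_and)
  have "code_sum \<psi> n z (f \<otimes>\<^bsub>GA\<^esub> h) \<kappa> = (\<Sum>(a, b)\<leftarrow>L. code_sum \<psi> n z f a * code_sum \<psi> n z h b)"
    if M: "(\<kappa>, L) \<in> M" for \<kappa> L
    by (rule S) (rule 1[OF M])
  then have "\<forall>(\<kappa>, L)\<in>M. code_sum \<psi> n z (f \<otimes>\<^bsub>GA\<^esub> h) \<kappa> =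
      (\<Sum>(a, b)\<leftarrow>L. code_sum \<psi> n z f a * code_sum \<psi> n z h b)"
    by blast
  then show ?thesis
    unfolding M_def
    by (simp add: block_coords_def Let_def block_monoid_def add_ac del: add_bit_eq_xor mult_bit_eq_and)
qed

lemma block_coords_one: "block_coords \<psi> n z \<one>\<^bsub>GA\<^esub> = \<one>\<^bsub>block_monoid K\<^esub>"
proof -
  have "code_sum \<psi> n z \<one>\<^bsub>GA\<^esub> \<kappa> = to_ac (\<kappa> code_one)" for \<kappa>
    unfolding code_sum_def
      weighted_sum_one[OF ring group_cyclic_times_D12 finite_cyclic_times_D12[OF n] emb]
    by (simp add: code_weight_def cyclic_times_D12_def D12_code_one)
  then show ?thesis
    by (simp add: block_coords_def Let_def block_monoid_def code_proj_defs code_one_def)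
qed

text \<open>Frobenius fixes the embedded coefficients and the bits, so raising to a power only moves
  the evaluation point. For a fixed \<open>z\<close> this places the coordinates in the fixed
  field.\<close>

lemma code_sum_power:
  assumes fixed: "\<And>x. x \<in> carrier R \<Longrightarrow> \<psi> x ^ 2 ^ m = \<psi> x" and f: "f \<in> carrier GA"
    and z: "z ^ 2 ^ m = z'"
  shows "code_sum \<psi> n z f \<kappa> ^ 2 ^ m = code_sum \<psi> n z' f \<kappa>"
  unfolding code_sum_def weighted_sum_def char_2_power_sum
proof (rule sum.cong)
  fix g assume "g \<in> carrier (cyclic_times_D12 n)"
  then have "f g \<in> carrier R"
    using f carrier_group_algebra[OF ring group_cyclic_times_D12 finite_cyclic_times_D12[OF n] emb] by auto
  moreover obtain i A where g: "g = (i, A)" by (cases g)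
  moreover have "to_ac b ^ 2 ^ m = to_ac b" for b :: bit
    by (cases b) (simp_all add: zero_power)
  moreover have "(z ^ nat i) ^ 2 ^ m = z' ^ nat i"
    by (simp add: mult.commute flip: power_mult z)
  ultimately show "(\<psi> (f g) * code_weight z \<kappa> g) ^ 2 ^ m = \<psi> (f g) * code_weight z' \<kappa> g"
    by (simp add: power_mult_distrib fixed code_weight_def)
qed simp

lemma block_coords_mem:
  assumes "\<And>x. x \<in> carrier R \<Longrightarrow> \<psi> x ^ 2 ^ m = \<psi> x" "f \<in> carrier GA" "z ^ 2 ^ m = z"
  shows "block_coords \<psi> n z f \<in> carrier (block_monoid (frobenius_fixed (2 ^ m)))"
  using code_sum_power[OF assms]
  by (simp add: block_coords_def Let_def block_monoid_def quads_def frobenius_fixed_def)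

text \<open>In characteristic 2 the sum of \<open>f\<close> and \<open>h\<close> is their
  difference. Its values at \<open>z\<close>, one for each element of \<open>D12\<close>, are
  orthogonal to the twelve coordinate functions, hence all zero.\<close>

lemma block_coords_eqD:
  assumes f: "f \<in> carrier GA" and h: "h \<in> carrier GA"
    and eq: "block_coords \<psi> n z f = block_coords \<psi> n z h" and A: "A \<in> carrier D12"
  shows "(\<Sum>i<n. (\<psi> (f (int i, A)) + \<psi> (h (int i, A))) * z ^ i) = 0"
proof -
  define u where "u A = (\<Sum>i<n. (\<psi> (f (int i, A)) + \<psi> (h (int i, A))) * z ^ i)" for A
  have sum: "(\<Sum>A\<in>carrier D12. u A * to_ac (\<kappa> (D12_code A))) = code_sum \<psi> n z f \<kappa> + code_sum \<psi> n z h \<kappa>" for \<kappa>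
  proof -
    have *: "code_sum \<psi> n z f \<kappa> =
        (\<Sum>A\<in>carrier D12. (\<Sum>i<n. \<psi> (f (int i, A)) * z ^ i) * to_ac (\<kappa> (D12_code A)))" for f
    proof -
      have "code_sum \<psi> n z f \<kappa> =
          (\<Sum>i\<in>{0..<int n}. \<Sum>A\<in>carrier D12. \<psi> (f (i, A)) * (z ^ nat i * to_ac (\<kappa> (D12_code A))))"
        unfolding code_sum_def weighted_sum_def code_weight_def carrier_cyclic_times_D12[OF n]
        by (simp add: sum.cartesian_product case_prod_unfold)
      also have "\<dots> = (\<Sum>i<n. \<Sum>A\<in>carrier D12. \<psi> (f (int i, A)) * (z ^ i * to_ac (\<kappa> (D12_code A))))"
        by (rule sum.reindex_bij_witness[of _ int nat]) auto
      also have "\<dots> = (\<Sum>A\<in>carrier D12. \<Sum>i<n. \<psi> (f (int i, A)) * (z ^ i * to_ac (\<kappa> (D12_code A))))"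
        by (rule sum.swap)
      finally show ?thesis by (simp add: sum_distrib_right mult.assoc)
    qed
    show ?thesis
      unfolding * u_def by (simp add: distrib_right sum.distrib)
  qed
  have T: "(\<Sum>A\<in>carrier D12. u A * to_ac (\<kappa> (D12_code A))) = 0"
    if "code_sum \<psi> n z f \<kappa> = code_sum \<psi> n z h \<kappa>" for \<kappa>
    unfolding sum that by (rule char_2_add_self)
  have "u A = 0"
    by (rule D12_code_functions_independent[where f = u, OF T[of "\<lambda>_. 1"] T[of code_b] T[of code_g]
            T[of "\<lambda>t. code_b t * code_g t"] T[of code_p] T[of code_q] T[of code_r] T[of code_s]
            T[of "\<lambda>t. code_g t * code_p t"] T[of "\<lambda>t. code_g t * code_q t"]
            T[of "\<lambda>t. code_g t * code_r t"] T[of "\<lambda>t. code_g t * code_s t"] A])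
      (use eq in \<open>simp_all add: block_coords_def Let_def del: add_bit_eq_xor mult_bit_eq_and\<close>)
  then show ?thesis by (simp add: u_def)
qed

lemma block_coords_inj:
  assumes fixed: "\<And>x. x \<in> carrier R \<Longrightarrow> \<psi> x ^ 2 ^ k = \<psi> x"
    and f: "f \<in> carrier GA" and h: "h \<in> carrier GA"
    and eq: "\<And>z. z \<in> Z \<Longrightarrow> block_coords \<psi> n z f = block_coords \<psi> n z h"
    and Z: "finite W" "card W \<ge> n" "\<And>w. w \<in> W \<Longrightarrow> \<exists>z\<in>Z. \<exists>i. w = z ^ (2 ^ k) ^ i"
  shows "f = h"
proof -
  note carr = carrier_group_algebra[OF ring group_cyclic_times_D12 finite_cyclic_times_D12[OF n] emb]
  have "f (i, A) = h (i, A)" if iA: "i \<in> {0..<int n}" "A \<in> carrier D12" for i A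
  proof -
    define a where "a i = \<psi> (f (int i, A)) + \<psi> (h (int i, A))" for i
    have c: "f (int i, A) \<in> carrier R" "h (int i, A) \<in> carrier R" if "i < n" for i
      using f h that iA unfolding carr by (auto simp: PiE_iff carrier_cyclic_times_D12[OF n])
    define p where "p = (\<Sum>i<n. Polynomial.monom (a i) i)"
    have poly_p: "poly p z = (\<Sum>i<n. a i * z ^ i)" for z
      by (simp add: p_def poly_sum poly_monom)
    \<comment> \<open>The coefficients \<open>a i\<close> are fixed by the \<open>2 ^ k\<close>-th
      power map, so \<open>p\<close> commutes with that map and a root of \<open>p\<close> brings
      its whole Frobenius orbit along.\<close>
    have frob: "poly p (z ^ (2 ^ k) ^ i) = poly p z ^ (2 ^ k) ^ i" for z i
    proof (induction i)
      case (Suc i)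
      have "poly p (z ^ (2 ^ k) ^ Suc i) = (\<Sum>i'<n. a i' ^ 2 ^ k * ((z ^ (2 ^ k) ^ i) ^ i') ^ 2 ^ k)"
        unfolding poly_p
      proof (rule sum.cong)
        fix i' assume "i' \<in> {..<n}"
        then have "a i' ^ 2 ^ k = a i'" by (simp add: a_def char_2_power_add fixed c)
        moreover have "(z ^ (2 ^ k) ^ Suc i) ^ i' = ((z ^ (2 ^ k) ^ i) ^ i') ^ 2 ^ k"
          by (simp only: power_mult[symmetric] power_Suc) (simp add: mult_ac)
        ultimately show "a i' * (z ^ (2 ^ k) ^ Suc i) ^ i' = a i' ^ 2 ^ k * ((z ^ (2 ^ k) ^ i) ^ i') ^ 2 ^ k"
          by simp
      qed simp
      also have "\<dots> = poly p (z ^ (2 ^ k) ^ i) ^ 2 ^ k"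
        by (simp add: poly_p char_2_power_sum power_mult_distrib)
      also have "\<dots> = poly p z ^ (2 ^ k) ^ Suc i"
        unfolding Suc by (simp add: mult.commute flip: power_mult)
      finally show ?case .
    qed simp
    have root: "poly p w = 0" if w: "w \<in> W" for w
    proof -
      obtain z i where z: "z \<in> Z" "w = z ^ (2 ^ k) ^ i" using Z(3)[OF w] by auto
      have "poly p z = 0"
        using block_coords_eqD[OF f h eq[OF z(1)] iA(2)] by (simp add: poly_p a_def)
      then show ?thesis by (simp add: z(2) frob)
    qed
    have "Polynomial.degree p < card W"
    proof -
      have "Polynomial.degree p \<le> n - 1"
        unfolding p_def by (intro degree_sum_le order.trans[OF degree_monom_le]) auto
      then show ?thesis using Z(2) n by linarith
    qed
    then have "p = 0"
      using root by (intro poly_eqI_degree[of W]) auto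
    have "Polynomial.coeff p j = a j" if "j < n" for j
    proof -
      have "Polynomial.coeff p j = (\<Sum>i<n. if i = j then a i else 0)"
        unfolding p_def Polynomial.coeff_sum by (intro sum.cong) auto
      then show ?thesis using that by simp
    qed
    then have "a (nat i) = 0" using \<open>p = 0\<close> iA(1) by force
    then have "\<psi> (f (i, A)) + \<psi> (h (i, A)) = 0" using iA(1) by (simp add: a_def)
    then have "\<psi> (f (i, A)) = \<psi> (h (i, A))"
      by (metis add_left_cancel char_2_add_self)
    then show ?thesis
      using field_embedding_inj[OF ring emb] c[of "nat i"] iA(1) by (auto dest: inj_onD)
  qed
  then show ?thesis
    using f h unfolding carr by (intro PiE_ext) (auto simp: carrier_cyclic_times_D12[OF n])
qed

end

section \<open>Frobenius orbits and units over one field\<close>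

text \<open>Multiplication by q permutes the residues prime to l, and each orbit has exactly
  \<open>ord l q\<close> elements because \<open>t\<close> can be cancelled modulo l. Hence the
  number of orbits is the quotient in the statement.\<close>

lemma orbit_representatives:
  fixes l q :: nat
  assumes "coprime l q" "l > 0"
  obtains r where "\<And>s. s < totient l div ord l q \<Longrightarrow> r s \<in> totatives l"
    "\<And>t. t \<in> totatives l \<Longrightarrow> \<exists>s<totient l div ord l q. \<exists>i. [t = r s * q ^ i] (mod l)"
\<comment> \<open>The only totative of 1 is 1 itself, which is not reduced modulo 1; the remaining
  argument relies on totatives being smaller than l.\<close>
proof (cases "l = 1")
  case True
  show thesis by (rule that[of "\<lambda>_. 1"]) (auto simp: True)
next
  case False
  then have l: "l > 1" using assms(2) by simp
  let ?T = "totatives l" and ?d = "ord l q"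
  define C where "C t = {x \<in> ?T. \<exists>i. [x = t * q ^ i] (mod l)}" for t
  have C_refl: "t \<in> C t" if "t \<in> ?T" for t
    using that by (auto simp: C_def intro: exI[of _ 0])
  have C_mono: "C t \<subseteq> C t'" if "[t = t' * q ^ j] (mod l)" for t t' j
  proof
    fix x assume "x \<in> C t"
    then obtain i where "x \<in> ?T" "[x = t * q ^ i] (mod l)" by (auto simp: C_def)
    moreover have "[t * q ^ i = t' * q ^ j * q ^ i] (mod l)"
      using that by (rule cong_scalar_right)
    ultimately have "x \<in> ?T" "[x = t' * q ^ (j + i)] (mod l)"
      by (auto simp: power_add mult.assoc dest: cong_trans)
    then show "x \<in> C t'" by (auto simp: C_def)
  qed
  have d: "?d > 0" using assms(1) by simp
  \<comment> \<open>Orbits must be symmetric, but exponents are natural numbers: since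
    \<open>q ^ ?d\<close> is 1 modulo l, the power \<open>q ^ (j * (?d - 1))\<close> inverts
    \<open>q ^ j\<close>.\<close>
  have inverse: "[t' = t * q ^ (j * (?d - 1))] (mod l)" if "[t = t' * q ^ j] (mod l)" for t t' j
  proof -
    have "[t * q ^ (j * (?d - 1)) = t' * q ^ j * q ^ (j * (?d - 1))] (mod l)"
      using that by (rule cong_scalar_right)
    also have "t' * q ^ j * q ^ (j * (?d - 1)) = t' * q ^ (?d * j)"
    proof -
      have "j + j * (?d - 1) = ?d * j" using d by (cases "?d") auto
      then show ?thesis by (simp add: mult.assoc flip: power_add)
    qed
    also have "[t' * q ^ (?d * j) = t' * 1] (mod l)"
      by (rule cong_scalar_left) (subst ord_divides, simp)
    finally show ?thesis by (simp add: cong_sym)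
  qed
  have C_eq: "C t = C t'" if "x \<in> C t" "x \<in> C t'" for x t t'
  proof -
    have sub: "C t \<subseteq> C t'" if x: "x \<in> C t" "x \<in> C t'" for t t'
    proof -
      obtain i j where "[x = t * q ^ i] (mod l)" "[x = t' * q ^ j] (mod l)"
        using x by (auto simp: C_def)
      from C_mono[OF this(2)] C_mono[OF inverse[OF this(1)]] show ?thesis by blast
    qed
    show ?thesis using sub that by blast
  qed
  have C_card: "card (C t) = ?d" if t: "t \<in> ?T" for t
  proof -
    have cop: "coprime t l" using t by (simp add: in_totatives_iff)
    have "bij_betw (\<lambda>i. t * q ^ i mod l) {..<?d} (C t)"
      unfolding bij_betw_def
    proof
      show "inj_on (\<lambda>i. t * q ^ i mod l) {..<?d}"
      proof (rule inj_onI)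
        fix i j assume ij: "i \<in> {..<?d}" "j \<in> {..<?d}" "t * q ^ i mod l = t * q ^ j mod l"
        then have "[q ^ i = q ^ j] (mod l)"
          using cop by (simp add: cong_mult_lcancel_nat flip: cong_def)
        then have "[i = j] (mod ?d)" using assms(1) by (simp add: order_divides_expdiff)
        then show "i = j" using ij by (simp add: cong_def)
      qed
      show "(\<lambda>i. t * q ^ i mod l) ` {..<?d} = C t"
      proof (intro equalityI subsetI)
        fix x assume "x \<in> (\<lambda>i. t * q ^ i mod l) ` {..<?d}"
        then obtain i where x: "x = t * q ^ i mod l" by auto
        have "coprime (t * q ^ i) l" using cop assms(1) by (auto simp: coprime_commute)
        then have "coprime x l" unfolding x using l by (subst coprime_mod_left_iff) auto
        moreover from this have "x > 0" using l by (cases "x = 0") auto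
        ultimately show "x \<in> C t"
          using l by (auto simp: C_def in_totatives_iff x less_imp_le cong_def)
      next
        fix x assume "x \<in> C t"
        then obtain i where x: "x \<in> ?T" "[x = t * q ^ i] (mod l)" by (auto simp: C_def)
        have "[q ^ i = q ^ (i mod ?d)] (mod l)" using assms(1) by (simp add: order_divides_expdiff)
        then have "[x = t * q ^ (i mod ?d)] (mod l)"
          using x(2) by (meson cong_scalar_left cong_trans)
        moreover have "x < l" using x(1) l by (simp add: totatives_less)
        ultimately have "x = t * q ^ (i mod ?d) mod l" by (simp add: cong_def)
        then show "x \<in> (\<lambda>i. t * q ^ i mod l) ` {..<?d}" using d by auto
      qed
    qed
    then show ?thesis by (metis bij_betw_same_card card_lessThan)
  qed
  let ?e = "totient l div ?d"
  have "?d * card (C ` ?T) = card (\<Union> (C ` ?T))"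
  proof (rule card_partition)
    show "finite (\<Union> (C ` ?T))" by (rule finite_subset[of _ ?T]) (auto simp: C_def)
    show "c \<inter> c' = {}" if "c \<in> C ` ?T" "c' \<in> C ` ?T" "c \<noteq> c'" for c c'
      using that C_eq by blast
  qed (auto simp: C_card)
  also have "\<Union> (C ` ?T) = ?T" using C_refl by (auto simp: C_def)
  finally have "card (C ` ?T) = ?e" using d unfolding totient_def by (metis less_not_refl nonzero_mult_div_cancel_left)
  then obtain g where g: "bij_betw g {..<?e} (C ` ?T)"
    using ex_bij_betw_nat_finite[of "C ` ?T"] by (auto simp: atLeast0LessThan)
  define r where "r s = (SOME t. t \<in> ?T \<and> C t = g s)" for s
  have r: "r s \<in> ?T \<and> C (r s) = g s" if "s < ?e" for s
  proof -
    have "g s \<in> C ` ?T" using g that by (auto simp: bij_betw_def)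
    then show ?thesis unfolding r_def by (intro someI_ex[of "\<lambda>t. t \<in> ?T \<and> C t = g s"]) auto
  qed
  show thesis
  proof (rule that)
    fix t assume t: "t \<in> ?T"
    then have "C t \<in> g ` {..<?e}" using g by (simp add: bij_betw_def)
    then obtain s where "s < ?e" "C t = g s" by auto
    then have "t \<in> C (r s)" using r C_refl[OF t] by simp
    then show "\<exists>s<?e. \<exists>i. [t = r s * q ^ i] (mod l)"
      using \<open>s < ?e\<close> by (auto simp: C_def)
  qed (use r in auto)
qed

section \<open>Unit groups of a finite field and of its matrices\<close>

lemma finite_field_generator:
  fixes R :: "('a, 'm) ring_scheme"
  assumes "field R" "finite (carrier R)" "field_embedding R \<psi>" "\<psi> ` carrier R = (K :: 'r::field set)"
  obtains b where "bij_betw (\<lambda>i. b ^ i) {..<card (carrier R) - 1} (K - {0})" "b ^ (card (carrier R) - 1) = 1"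
proof -
  interpret field R by fact
  interpret M: group "Multiplicative_Group.mult_of R" by (rule field_mult_group)
  note emb = field_embedding_mult[OF ring_axioms assms(3)] field_embedding_one[OF ring_axioms assms(3)]
    field_embedding_inj[OF ring_axioms assms(3)]
    field_embedding_eq_0_iff[OF ring_axioms assms(3)]
  obtain a where a: "a \<in> carrier (Multiplicative_Group.mult_of R)"
    "carrier (Multiplicative_Group.mult_of R) = {a [^]\<^bsub>R\<^esub> i | i::nat. i \<in> UNIV}"
    using finite_field_mult_group_has_gen[OF assms(2)] by auto
  let ?N = "card (carrier R) - 1"
  have pow: "\<psi> (a [^]\<^bsub>R\<^esub> i) = \<psi> a ^ i" for i :: nat
    using a(1) by (induction i) (simp_all add: emb mult.commute)
  have "a [^]\<^bsub>Multiplicative_Group.mult_of R\<^esub> ?N = \<one>\<^bsub>R\<^esub>"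
    using M.pow_order_eq_1[OF a(1)] assms(2) by (simp add: Coset.order_def)
  then have one: "\<psi> a ^ ?N = 1"
    using pow[of ?N] by (simp add: Multiplicative_Group.nat_pow_mult_of emb)
  have K: "K - {0} = \<psi> ` carrier (Multiplicative_Group.mult_of R)"
    using emb by (auto simp: assms(4)[symmetric])
  have card: "card (K - {0}) = ?N"
    unfolding K using emb(3) assms(2) by (subst card_image) (auto intro: inj_on_subset)
  have N: "?N > 0"
    using a(1) assms(2) card by (metis K card_gt_0_iff empty_iff finite_Diff finite_imageI image_is_empty assms(4))
  have "K - {0} = (\<lambda>i. \<psi> a ^ i) ` {..<?N}"
  proof (intro equalityI subsetI)
    fix x assume "x \<in> K - {0}"
    then obtain i :: nat where "x = \<psi> a ^ i" unfolding K a(2) by (auto simp: pow)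
    also have "\<dots> = \<psi> a ^ (?N * (i div ?N) + i mod ?N)" by simp
    also have "\<dots> = \<psi> a ^ (i mod ?N)" unfolding power_add power_mult one by simp
    finally show "x \<in> (\<lambda>i. \<psi> a ^ i) ` {..<?N}" using N by auto
  next
    fix x assume "x \<in> (\<lambda>i. \<psi> a ^ i) ` {..<?N}"
    then obtain i where "x = \<psi> a ^ i" by auto
    then show "x \<in> K - {0}" unfolding K a(2) by (auto simp flip: pow)
  qed
  moreover from this have "inj_on (\<lambda>i. \<psi> a ^ i) {..<?N}"
    using card by (intro eq_card_imp_inj_on) auto
  ultimately have "bij_betw (\<lambda>i. \<psi> a ^ i) {..<?N} (K - {0})" by (simp add: bij_betw_def)
  then show thesis using one by (rule that)
qed

lemma units_scalar_monoid:
  fixes K :: "'r::field set"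
  assumes K: "subring_set K" and b: "bij_betw (\<lambda>i. b ^ i) {..<N} (K - {0})" "b ^ N = 1" and "N > 0"
  shows "units_of (scalar_monoid K) \<cong> integer_mod_group N"
proof -
  \<comment> \<open>All powers of \<open>b\<close> stay in K, in particular
    \<open>b ^ (N - i)\<close>, the inverse of \<open>b ^ i\<close>; \<open>subring_set\<close> by
    itself says nothing about inverses.\<close>
  have mem: "b ^ i \<in> K - {0}" for i
  proof -
    have "b ^ i = b ^ (N * (i div N) + i mod N)" by simp
    also have "\<dots> = b ^ (i mod N)" unfolding power_add power_mult b(2) by simp
    also have "\<dots> \<in> (\<lambda>i. b ^ i) ` {..<N}" using \<open>N > 0\<close> by simp
    also have "\<dots> = K - {0}" using b(1) by (simp add: bij_betw_def)
    finally show ?thesis .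
  qed
  have units: "Units (scalar_monoid K) = K - {0}"
  proof (intro equalityI subsetI)
    fix x assume x: "x \<in> K - {0}"
    then obtain i where i: "i < N" "x = b ^ i" using b(1) by (auto simp: bij_betw_def)
    have "b ^ (N - i) * x = 1" using i b(2) by (simp flip: power_add)
    then show "x \<in> Units (scalar_monoid K)"
      using x mem[of "N - i"] by (auto simp: Units_def scalar_monoid_def mult.commute)
  qed (auto simp: Units_def scalar_monoid_def)
  have "(\<lambda>i. b ^ nat i) \<in> Group.iso (integer_mod_group N) (units_of (scalar_monoid K))"
    unfolding iso_def
  proof (intro CollectI conjI homI)
    show "b ^ nat x \<in> carrier (units_of (scalar_monoid K))" for x
      using mem[of "nat x"] by (simp add: units_of_carrier units)
    show "b ^ nat (x \<otimes>\<^bsub>integer_mod_group N\<^esub> y) = b ^ nat x \<otimes>\<^bsub>units_of (scalar_monoid K)\<^esub> b ^ nat y"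
      if "x \<in> carrier (integer_mod_group N)" "y \<in> carrier (integer_mod_group N)" for x y
      using that power_nat_mod[OF b(2)] \<open>N > 0\<close>
      by (simp add: units_of_mult scalar_monoid_def carrier_integer_mod_group)
    have "bij_betw nat {0..<int N} {..<N}"
      by (rule bij_betw_byWitness[where f' = int]) auto
    then have "bij_betw ((\<lambda>i. b ^ i) \<circ> nat) {0..<int N} (K - {0})"
      using b(1) by (rule bij_betw_trans)
    then show "bij_betw (\<lambda>i. b ^ nat i) (carrier (integer_mod_group N)) (carrier (units_of (scalar_monoid K)))"
      using \<open>N > 0\<close> by (simp add: carrier_integer_mod_group units_of_carrier units comp_def)
  qed
  then show ?thesis
    by (meson group.iso_sym group_integer_mod_group is_iso_def is_isoI)
qed

text \<open>Equations can be checked after an injective multiplicative map. The monoid laws of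
  \<open>group_algebra\<close> and \<open>matrix_ring\<close> are thus read off from the concrete
  models, without manipulating nested sums.\<close>

lemma monoid_pullback:
  assumes "monoid M" and f: "inj_on f (carrier G)" "f ` carrier G \<subseteq> carrier M"
    and closed: "\<And>x y. x \<in> carrier G \<Longrightarrow> y \<in> carrier G \<Longrightarrow> x \<otimes>\<^bsub>G\<^esub> y \<in> carrier G"
    and mult: "\<And>x y. x \<in> carrier G \<Longrightarrow> y \<in> carrier G \<Longrightarrow> f (x \<otimes>\<^bsub>G\<^esub> y) = f x \<otimes>\<^bsub>M\<^esub> f y"
    and one: "\<one>\<^bsub>G\<^esub> \<in> carrier G" "f \<one>\<^bsub>G\<^esub> = \<one>\<^bsub>M\<^esub>"
  shows "monoid G"
proof -
  interpret M: monoid M by fact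
  have c: "f x \<in> carrier M" if "x \<in> carrier G" for x using f(2) that by auto
  show ?thesis
    by (rule monoidI; (rule inj_onD[OF f(1)])?)
      (simp_all add: closed mult one c M.m_assoc)
qed

context
  fixes R :: "('a, 'm) ring_scheme" and \<psi> :: "'a \<Rightarrow> 'r::field" and K
  assumes ring: "ring R" and emb: "field_embedding R \<psi>" and img: "\<psi> ` carrier R = K"
begin

interpretation ring R by (rule ring)

definition "quad_of_matrix A = (\<psi> (A (0::nat, 0::nat)), \<psi> (A (0, 1)), \<psi> (A (1, 0)), \<psi> (A (1, 1)))"

lemma matrix_ring_entry:
  assumes "A \<in> carrier (matrix_ring 2 R)" "i < 2" "j < 2"
  shows "A (i, j) \<in> carrier R"
  using assms by (auto simp: matrix_ring_def PiE_iff)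

lemma matrix_ring_mult_closed:
  assumes "A \<in> carrier (matrix_ring 2 R)" "B \<in> carrier (matrix_ring 2 R)"
  shows "A \<otimes>\<^bsub>matrix_ring 2 R\<^esub> B \<in> carrier (matrix_ring 2 R)"
proof -
  note e = matrix_ring_entry[OF assms(1)] matrix_ring_entry[OF assms(2)]
  show ?thesis
    using e by (auto simp: matrix_ring_def intro!: finsum_closed)
qed

lemma quad_of_matrix_mult:
  assumes "A \<in> carrier (matrix_ring 2 R)" "B \<in> carrier (matrix_ring 2 R)"
  shows "quad_of_matrix (A \<otimes>\<^bsub>matrix_ring 2 R\<^esub> B) = quad_matrix_mult (quad_of_matrix A) (quad_of_matrix B)"
proof -
  note e = matrix_ring_entry[OF assms(1)] matrix_ring_entry[OF assms(2)]
  have "\<psi> ((A \<otimes>\<^bsub>matrix_ring 2 R\<^esub> B) (i, j)) = \<psi> (A (i, 0)) * \<psi> (B (0, j)) + \<psi> (A (i, 1)) * \<psi> (B (1, j))"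
    if "i < 2" "j < 2" for i j
  proof -
    have "\<psi> ((A \<otimes>\<^bsub>matrix_ring 2 R\<^esub> B) (i, j)) = \<psi> (\<Oplus>\<^bsub>R\<^esub>k\<in>{..<2}. A (i, k) \<otimes>\<^bsub>R\<^esub> B (k, j))"
      using that by (simp add: matrix_ring_def)
    also have "\<dots> = (\<Sum>k<2. \<psi> (A (i, k) \<otimes>\<^bsub>R\<^esub> B (k, j)))"
      using e that by (intro field_embedding_finsum[OF ring emb]) auto
    also have "\<dots> = (\<Sum>k<2. \<psi> (A (i, k)) * \<psi> (B (k, j)))"
      using e that by (intro sum.cong) (auto simp: field_embedding_mult[OF ring emb])
    finally show ?thesis by (simp add: eval_nat_numeral)
  qed
  then show ?thesis by (simp add: quad_of_matrix_def)
qed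

lemma bij_betw_quad_of_matrix:
  "bij_betw quad_of_matrix (carrier (matrix_ring 2 R)) (carrier (matrix_monoid K))"
  unfolding bij_betw_def
proof
  show "inj_on quad_of_matrix (carrier (matrix_ring 2 R))"
  proof (rule inj_onI)
    fix A B assume AB: "A \<in> carrier (matrix_ring 2 R)" "B \<in> carrier (matrix_ring 2 R)"
      and eq: "quad_of_matrix A = quad_of_matrix B"
    note e = matrix_ring_entry[OF AB(1)] matrix_ring_entry[OF AB(2)]
    have "\<psi> (A (i, j)) = \<psi> (B (i, j))" if "i < 2" "j < 2" for i j
      using eq that by (auto simp: quad_of_matrix_def less_2_cases_iff)
    then have "A (i, j) = B (i, j)" if "i < 2" "j < 2" for i j
      using e[OF that] that field_embedding_inj[OF ring emb] by (auto dest: inj_onD)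
    then show "A = B"
      using AB unfolding matrix_ring_def by (intro PiE_ext[of A "{..<2} \<times> {..<2}" "\<lambda>_. carrier R" B]) auto
  qed
  show "quad_of_matrix ` carrier (matrix_ring 2 R) = carrier (matrix_monoid K)"
  proof (intro equalityI subsetI)
    fix x assume "x \<in> quad_of_matrix ` carrier (matrix_ring 2 R)"
    then show "x \<in> carrier (matrix_monoid K)"
      by (auto simp: quad_of_matrix_def matrix_monoid_def quads_def img[symmetric] matrix_ring_entry)
  next
    fix x assume "x \<in> carrier (matrix_monoid K)"
    then obtain a b c d where x: "x = (\<psi> a, \<psi> b, \<psi> c, \<psi> d)"
      and R: "a \<in> carrier R" "b \<in> carrier R" "c \<in> carrier R" "d \<in> carrier R"
      by (auto simp: matrix_monoid_def quads_def img[symmetric])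
    let ?A = "\<lambda>(i, j)\<in>{..<2::nat} \<times> {..<2::nat}. if i = 0 then if j = 0 then a else b else if j = 0 then c else d"
    have "?A \<in> carrier (matrix_ring 2 R)" using R by (auto simp: matrix_ring_def)
    moreover have "x = quad_of_matrix ?A" by (simp add: quad_of_matrix_def x)
    ultimately show "x \<in> quad_of_matrix ` carrier (matrix_ring 2 R)" by blast
  qed
qed

lemma matrix_ring_one: "\<one>\<^bsub>matrix_ring 2 R\<^esub> \<in> carrier (matrix_ring 2 R)"
  "quad_of_matrix \<one>\<^bsub>matrix_ring 2 R\<^esub> = (1, 0, 0, 1)"
  by (auto simp: matrix_ring_def quad_of_matrix_def field_embedding_zero[OF ring emb] field_embedding_one[OF ring emb])

lemma monoid_matrix_ring:
  assumes "subring_set K"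
  shows "monoid (matrix_ring 2 R)"
  by (rule monoid_pullback[OF monoid_matrix_monoid[OF assms], of quad_of_matrix])
    (use bij_betw_quad_of_matrix in \<open>auto simp: bij_betw_def matrix_ring_mult_closed matrix_ring_one
      quad_of_matrix_mult matrix_monoid_def\<close>)

lemma units_matrix_monoid:
  assumes "subring_set K"
  shows "units_of (matrix_monoid K) \<cong> GL 2 R" "group (GL 2 R)"
proof -
  show grp: "group (GL 2 R)"
    unfolding GL_def by (rule monoid.units_group) (rule monoid_matrix_ring[OF assms])
  have "quad_of_matrix \<in> Group.iso (matrix_ring 2 R) (matrix_monoid K)"
    using bij_betw_quad_of_matrix
    by (auto simp: iso_def hom_def bij_betw_def quad_of_matrix_mult) (auto simp: matrix_monoid_def quad_of_matrix_mult)
  then have "GL 2 R \<cong> units_of (matrix_monoid K)"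
    unfolding GL_def by (intro units_of_is_iso monoid_matrix_ring monoid_matrix_monoid assms)
  then show "units_of (matrix_monoid K) \<cong> GL 2 R"
    using grp by (simp add: group.iso_sym)
qed

end

section \<open>The decomposition\<close>

text \<open>The set K depends only on the cardinality, whereas R may have any type. This lets the
  factors of the decomposition, all built inside one closure, be compared with \<open>F\<close> and
  with the extensions.\<close>

lemma field_unit_groups:
  fixes R :: "('a, 'm) ring_scheme"
  assumes "field R" "finite (carrier R)" "\<one>\<^bsub>R\<^esub> \<oplus>\<^bsub>R\<^esub> \<one>\<^bsub>R\<^esub> = \<zero>\<^bsub>R\<^esub>" and card: "card (carrier R) = 2 ^ m"
  defines "K \<equiv> frobenius_fixed (2 ^ m)"
  shows "card K = 2 ^ m" "units_of (scalar_monoid K) \<cong> integer_mod_group (2 ^ m - 1)"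
    "units_of (matrix_monoid K) \<cong> GL 2 R" "group (GL 2 R)"
    "\<exists>b. bij_betw (\<lambda>i. b ^ i) {..<2 ^ m - 1} (K - {0}) \<and> b ^ (2 ^ m - 1) = 1"
    "m > 0"
proof -
  interpret field R by fact
  obtain \<psi> :: "'a \<Rightarrow> bit alg_closure" where emb: "field_embedding R \<psi>"
    and img: "\<psi> ` carrier R = {x. x ^ card (carrier R) = x}"
    using finite_field_embedding[OF assms(1-3)] by blast
  have img: "\<psi> ` carrier R = K"
    using img by (simp add: K_def frobenius_fixed_def card)
  have K: "subring_set K" by (simp add: K_def subring_set_frobenius_fixed)
  show "card K = 2 ^ m"
    using field_embedding_inj[OF ring_axioms emb] card by (simp add: card_image flip: img)
  have "card {\<zero>\<^bsub>R\<^esub>, \<one>\<^bsub>R\<^esub>} \<le> card (carrier R)"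
    by (rule card_mono[OF assms(2)]) simp
  then have "(2::nat) \<le> 2 ^ m" by (simp add: card)
  then show m: "m > 0" by (cases m) auto
  obtain b where b: "bij_betw (\<lambda>i. b ^ i) {..<2 ^ m - 1} (K - {0})" "b ^ (2 ^ m - 1) = 1"
    using finite_field_generator[OF assms(1,2) emb img] unfolding card by blast
  then show "\<exists>b. bij_betw (\<lambda>i. b ^ i) {..<2 ^ m - 1} (K - {0}) \<and> b ^ (2 ^ m - 1) = 1" by blast
  \<comment> \<open>The modulus \<open>2 ^ m - 1\<close> must be positive, because
    \<open>integer_mod_group 0\<close> is the infinite group of integers.\<close>
  have "(1::nat) < 2 ^ m" using m by (rule one_less_power[rotated]) simp
  then show "units_of (scalar_monoid K) \<cong> integer_mod_group (2 ^ m - 1)"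
    by (intro units_scalar_monoid[OF K b]) simp
  show "units_of (matrix_monoid K) \<cong> GL 2 R" "group (GL 2 R)"
    by (rule units_matrix_monoid[OF ring_axioms emb img K])+
qed

text \<open>The hypotheses isolate what the choice of roots must provide: \<open>z\<close> places
  the coordinates in the right fields, \<open>cover\<close> makes the evaluation injective, and
  \<open>card_prod\<close> makes it surjective by counting.\<close>

lemma units_group_algebra_iso:
  fixes R :: "('a, 'm) ring_scheme" and J :: "'j set" and z :: "'j \<Rightarrow> bit alg_closure"
  assumes "field R" "finite (carrier R)" "\<one>\<^bsub>R\<^esub> \<oplus>\<^bsub>R\<^esub> \<one>\<^bsub>R\<^esub> = \<zero>\<^bsub>R\<^esub>" and card: "card (carrier R) = 2 ^ k"
    and n: "n > 0" and J: "finite J"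
    and z: "\<And>j. j \<in> J \<Longrightarrow> z j ^ n = 1" "\<And>j. j \<in> J \<Longrightarrow> z j ^ 2 ^ (k * d j) = z j"
    and cover: "finite W" "card W \<ge> n" "\<And>w. w \<in> W \<Longrightarrow> \<exists>j\<in>J. \<exists>i. w = z j ^ (2 ^ k) ^ i"
    and card_prod: "(\<Prod>j\<in>J. card (frobenius_fixed (2 ^ (k * d j)))) = (2 ^ k) ^ n"
  shows "units_of (group_algebra R (integer_mod_group n \<times>\<times> D12)) \<cong>
    units_of (product_group J (\<lambda>j. block_monoid (frobenius_fixed (2 ^ (k * d j)))))"
proof -
  interpret field R by fact
  obtain \<psi> :: "'a \<Rightarrow> bit alg_closure" where emb: "field_embedding R \<psi>"
    and img: "\<psi> ` carrier R = {x. x ^ card (carrier R) = x}"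
    using finite_field_embedding[OF assms(1-3)] by blast
  have fixed: "\<psi> x ^ 2 ^ k = \<psi> x" if "x \<in> carrier R" for x
  proof -
    have "\<psi> x \<in> {x. x ^ card (carrier R) = x}" using img that by blast
    then show ?thesis by (simp add: card)
  qed
  have fixed': "\<psi> x ^ 2 ^ (k * m) = \<psi> x" if "x \<in> carrier R" for x m
  proof (induction m)
    case (Suc m)
    have "\<psi> x ^ 2 ^ (k * Suc m) = (\<psi> x ^ 2 ^ (k * m)) ^ 2 ^ k"
      by (simp add: power_add mult.commute flip: power_mult)
    then show ?case using Suc fixed[OF that] by simp
  qed simp
  let ?GA = "group_algebra R (cyclic_times_D12 n)"
  let ?K = "\<lambda>j. frobenius_fixed (2 ^ (k * d j))"
  let ?V = "product_group J (\<lambda>j. block_monoid (?K j))"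
  let ?f = "\<lambda>f. \<lambda>j\<in>J. block_coords \<psi> n (z j) f"
  note ga = group_cyclic_times_D12 finite_cyclic_times_D12[OF n] emb
  note closed = group_algebra_mult_closed[OF ring_axioms ga]
  have V: "monoid ?V"
    by (intro monoid_product_group monoid_block_monoid subring_set_frobenius_fixed)
  have mem: "?f f \<in> carrier ?V" if "f \<in> carrier ?GA" for f
    using block_coords_mem[OF ring_axioms emb n fixed' that z(2)] by simp
  have mult: "?f (f \<otimes>\<^bsub>?GA\<^esub> h) = ?f f \<otimes>\<^bsub>?V\<^esub> ?f h" if "f \<in> carrier ?GA" "h \<in> carrier ?GA" for f h
    using block_coords_mult[OF ring_axioms emb n that z(1)] by (auto simp: fun_eq_iff)
  have inj: "inj_on ?f (carrier ?GA)"
  proof (rule inj_onI)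
    fix f h assume fh: "f \<in> carrier ?GA" "h \<in> carrier ?GA" "?f f = ?f h"
    have eq: "block_coords \<psi> n (z j) f = block_coords \<psi> n (z j) h" if "j \<in> J" for j
      using fun_cong[OF fh(3), of j] that by simp
    show "f = h"
      by (rule block_coords_inj[OF ring_axioms emb n fixed fh(1,2), of "z ` J" W])
        (use eq cover in auto)
  qed
  have finV: "finite (carrier ?V)" and cardV: "card (carrier ?V) = card (carrier ?GA)"
  proof -
    have fin: "finite (?K j)" if "j \<in> J" for j
    proof -
      \<comment> \<open>An infinite set has \<open>card\<close> equal to 0, and a zero factor would
        spoil the product, which is a power of 2.\<close>
      have "card (?K j) \<noteq> 0" using card_prod J that by (metis prod_zero power_not_zero zero_neq_numeral)
      then show ?thesis by (metis card.infinite)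
    qed
    then show "finite (carrier ?V)"
      using J by (auto simp: block_monoid_def quads_def intro!: finite_PiE)
    \<comment> \<open>Each block has 12 coordinates, and the group has \<open>12 * n\<close>
      elements; both sides come to the twelfth power of \<open>(2 ^ k) ^ n\<close>.\<close>
    have "card (carrier ?V) = (\<Prod>j\<in>J. card (?K j) ^ 12)"
      using J by (simp add: card_PiE block_monoid_def quads_def card_cartesian_product
          power_numeral_reduce mult.assoc)
    also have "\<dots> = ((2 ^ k) ^ n) ^ 12" by (simp only: prod_power_distrib[symmetric] card_prod)
    also have "\<dots> = card (carrier ?GA)"
      unfolding carrier_group_algebra[OF ring_axioms ga]
      by (simp add: card_PiE finite_cyclic_times_D12[OF n] card_cyclic_times_D12[OF n] card mult_ac flip: power_mult)
    finally show "card (carrier ?V) = card (carrier ?GA)" .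
  qed
  have img: "?f ` carrier ?GA = carrier ?V"
  proof (rule card_subset_eq[OF finV])
    show "?f ` carrier ?GA \<subseteq> carrier ?V" using mem by blast
    show "card (?f ` carrier ?GA) = card (carrier ?V)" by (simp only: card_image[OF inj] cardV)
  qed
  have one: "?f \<one>\<^bsub>?GA\<^esub> = \<one>\<^bsub>?V\<^esub>"
    using block_coords_one[OF ring_axioms emb n] by (auto simp: fun_eq_iff)
  have GA: "monoid ?GA"
  proof (rule monoid_pullback[where f = ?f and M = ?V])
    show "?f ` carrier ?GA \<subseteq> carrier ?V" using mem by blast
  qed (fact V inj one group_algebra_one_closed[OF ring_axioms ga] | erule (1) closed mult)+
  have "?f \<in> Group.iso ?GA ?V"
    unfolding iso_def hom_def bij_betw_def using inj img mem mult by blast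
  then have "units_of ?GA \<cong> units_of ?V" by (rule units_of_is_iso[OF GA V])
  then show ?thesis by (simp add: cyclic_times_D12_def)
qed

text \<open>Serves to split off the divisor \<open>a = 1\<close>, which has a single orbit, so that
  its factor appears outside the product over the remaining divisors.\<close>

lemma product_group_Sigma_iso:
  fixes e :: "'i \<Rightarrow> nat"
  assumes a: "a \<notin> L" "e a = 1"
  shows "product_group (SIGMA l:insert a L. {..<e l}) (\<lambda>j. S (fst j) \<times>\<times> M (fst j)) \<cong>
    S a \<times>\<times> M a \<times>\<times> product_group L (\<lambda>l. direct_power (S l \<times>\<times> M l) (e l))"
proof -
  let ?J = "SIGMA l:insert a L. {..<e l}"
  let ?P = "product_group ?J (\<lambda>j. S (fst j) \<times>\<times> M (fst j))"
  let ?Q = "S a \<times>\<times> M a \<times>\<times> product_group L (\<lambda>l. direct_power (S l \<times>\<times> M l) (e l))"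
  let ?f = "\<lambda>x. (fst (x (a, 0)), snd (x (a, 0)), \<lambda>l\<in>L. \<lambda>s\<in>{..<e l}. x (l, s))"
  let ?g = "\<lambda>(c, m, y). \<lambda>(l, s)\<in>?J. if l = a then (c, m) else y l s"
  have a0: "(a, 0) \<in> ?J" using a by simp
  have f_closed: "?f x \<in> carrier ?Q" if "x \<in> carrier ?P" for x
  proof -
    have "x j \<in> carrier (S (fst j)) \<times> carrier (M (fst j))" if "j \<in> ?J" for j
      using \<open>x \<in> carrier ?P\<close> that by (auto simp: PiE_iff)
    from this[OF a0] this[of "(_, _)"] show ?thesis
      by (auto simp: direct_power_def mem_Times_iff)
  qed
  have "?f \<in> Group.iso ?P ?Q"
    unfolding iso_def
  proof (intro CollectI conjI homI f_closed)
    fix x y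
    show "?f (x \<otimes>\<^bsub>?P\<^esub> y) = ?f x \<otimes>\<^bsub>?Q\<^esub> ?f y"
      using a0 by (auto simp: direct_power_def fun_eq_iff DirProd_def split_beta)
  next
    show "bij_betw ?f (carrier ?P) (carrier ?Q)"
    proof (rule bij_betw_byWitness[where f' = ?g])
      show "\<forall>x\<in>carrier ?P. ?g (?f x) = x"
      proof
        fix x assume "x \<in> carrier ?P"
        then have "x \<in> extensional ?J" by (simp add: PiE_iff)
        then show "?g (?f x) = x"
          using a by (auto simp: fun_eq_iff extensional_def)
      qed
      show "\<forall>y\<in>carrier ?Q. ?f (?g y) = y"
        using a by (auto simp: fun_eq_iff direct_power_def PiE_iff extensional_def)
      show "?f ` carrier ?P \<subseteq> carrier ?Q" using f_closed by blast
      show "?g ` carrier ?Q \<subseteq> carrier ?P"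
      proof (intro image_subsetI)
        fix y assume "y \<in> carrier ?Q"
        then obtain c m y' where y: "y = (c, m, y')" and cm: "c \<in> carrier (S a)" "m \<in> carrier (M a)"
          and y': "y' \<in> (\<Pi>\<^sub>E l\<in>L. \<Pi>\<^sub>E s\<in>{..<e l}. carrier (S l) \<times> carrier (M l))"
          by (auto simp: direct_power_def)
        have "y' l s \<in> carrier (S l) \<times> carrier (M l)" if "l \<in> L" "s < e l" for l s
          using y' that by (auto simp: PiE_iff)
        then show "?g y \<in> carrier ?P"
          using cm by (auto simp: y restrict_PiE_iff)
      qed
    qed
  qed
  then show ?thesis by (auto simp: is_iso_def)
qed

theorem theorem3p1:
  fixes F :: "('a, 'm) ring_scheme"
    and E :: "nat \<Rightarrow> ('b, 'c) ring_scheme"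
    and n k q :: nat
    and d e :: "nat \<Rightarrow> nat"
  assumes "field F" and "finite (carrier F)" and "ring_characteristic F = 2"
    and "q = 2 ^ k" and "card (carrier F) = q"
    and "odd n"
    and "\<And>l. d l = ord l q"
    and "\<And>l. e l = totient l div d l"
    and "\<And>l. l dvd n \<Longrightarrow> l > 1 \<Longrightarrow> field_extension_of_degree F (E (d l)) (d l)"
  shows "iso_semidirect_product
    (units_of (group_algebra F (integer_mod_group n \<times>\<times> D12)))
    (direct_power (integer_mod_group 2) (7 * n * k))
    (integer_mod_group (q - 1) \<times>\<times> GL 2 F \<times>\<times>
      product_group {l. l > 1 \<and> l dvd n}
        (\<lambda>l. direct_power (integer_mod_group (q ^ d l - 1) \<times>\<times> GL 2 (E (d l))) (e l)))"
proof -
  interpret F: field F by fact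
  have n: "n > 0" using \<open>odd n\<close> by (cases n) auto
  have d1: "d 1 = 1" and e1: "e 1 = 1" by (simp_all add: assms)
  have cop: "coprime l q" if "l dvd n" for l
  proof -
    have "odd l" using that \<open>odd n\<close> by (meson dvd_trans)
    then show ?thesis by (simp add: assms(4) coprime_right_2_iff_odd)
  qed
  have q_pow: "q ^ m = 2 ^ (k * m)" for m by (simp add: assms(4) power_mult)
  have two: "\<one>\<^bsub>F\<^esub> \<oplus>\<^bsub>F\<^esub> \<one>\<^bsub>F\<^esub> = \<zero>\<^bsub>F\<^esub>"
  proof -
    let ?P = "\<lambda>m::nat. m > 0 \<and> add_pow F m \<one>\<^bsub>F\<^esub> = \<zero>\<^bsub>F\<^esub>"
    have "\<exists>m. ?P m" and "(LEAST m. ?P m) = 2"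
      using assms(3) by (auto simp: ring_characteristic_def split: if_splits)
    then have "add_pow F (2::nat) \<one>\<^bsub>F\<^esub> = \<zero>\<^bsub>F\<^esub>" using LeastI_ex[of ?P] by simp
    then show ?thesis by (simp add: numeral_2_eq_2)
  qed
  have cardF: "card (carrier F) = 2 ^ (k * 1)" by (simp add: assms)
  note F_groups = field_unit_groups[OF assms(1,2) two cardF]
  note ext = card_field_extension[OF assms(1,2) assms(9)]
  have E_card: "card (carrier (E (d l))) = 2 ^ (k * d l)" if "l dvd n" "l > 1" for l
    using ext(3)[OF that] by (simp add: assms(5) q_pow)
  note E_groups = field_unit_groups[OF ext(1,2) ext(4)[OF _ _ two] E_card]
  let ?K = "\<lambda>l. frobenius_fixed (2 ^ (k * d l))"
  have K_card: "card (?K l) = q ^ d l" if "l dvd n" for l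
  proof (cases "l > 1")
    case False
    then have "l = 1" using that n by (cases l) auto
    then show ?thesis using F_groups(1) unfolding \<open>l = 1\<close> d1 q_pow by simp
  qed (use E_groups(1) that in \<open>simp add: q_pow\<close>)
  \<comment> \<open>A primitive n-th root of unity. As \<open>q ^ d n\<close> is 1 modulo n, n
    divides the order of the multiplicative group of the field with \<open>q ^ d n\<close> elements,
    and a suitable power of a generator has order n. For \<open>n = 1\<close> no extension is
    supplied, and \<open>w = 1\<close> serves.\<close>
  obtain w :: "bit alg_closure" where w: "w ^ n = 1" "inj_on (\<lambda>i. w ^ i) {..<n}"
  proof (cases "n = 1")
    case True
    then show thesis by (intro that[of 1]) (auto simp: inj_on_def)
  next
    case False
    then have n1: "n > 1" using n by simp
    let ?N = "2 ^ (k * d n) - 1 :: nat"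
    obtain b :: "bit alg_closure" where b: "inj_on (\<lambda>i. b ^ i) {..<?N}" "b ^ ?N = 1"
      using E_groups(5)[of n] n1 by (auto simp: bij_betw_def)
    have "[q ^ d n = 1] (mod n)" unfolding assms(7) by (rule ord)
    then have "n dvd ?N" unfolding q_pow by (rule cong_to_1_nat)
    then obtain c where c: "?N = n * c" by (elim dvdE)
    have "?N > 0"
    proof -
      have "(1::nat) < 2 ^ (k * d n)" using E_groups(6)[of n] n1 by (intro one_less_power) auto
      then show ?thesis by simp
    qed
    then have c0: "c > 0" unfolding c by simp
    show thesis
    proof (rule that[of "b ^ c"])
      show "(b ^ c) ^ n = 1" using b(2) unfolding c by (simp add: mult.commute flip: power_mult)
      show "inj_on (\<lambda>i. (b ^ c) ^ i) {..<n}"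
      proof (rule inj_onI)
        fix i j assume ij: "i \<in> {..<n}" "j \<in> {..<n}" "(b ^ c) ^ i = (b ^ c) ^ j"
        have "c * i < ?N" "c * j < ?N" unfolding c using ij c0 by (simp_all add: mult.commute)
        moreover have "b ^ (c * i) = b ^ (c * j)" using ij(3) by (simp add: power_mult)
        ultimately have "c * i = c * j" using b(1) by (auto dest: inj_onD)
        then show "i = j" using c0 by simp
      qed
    qed
  qed
  have w_cong: "w ^ i = w ^ j" if "[i = j] (mod n)" for i j
  proof -
    have "w ^ m = w ^ (m mod n)" for m
    proof -
      have "w ^ m = w ^ (n * (m div n) + m mod n)" by simp
      also have "\<dots> = w ^ (m mod n)" unfolding power_add power_mult w(1) by simp
      finally show ?thesis .
    qed
    then show ?thesis using that unfolding cong_def by metis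
  qed
  have "\<exists>r. (\<forall>s<e l. r s \<in> totatives l) \<and> (\<forall>t\<in>totatives l. \<exists>s<e l. \<exists>i. [t = r s * q ^ i] (mod l))"
    if "l dvd n" for l
    using orbit_representatives[OF cop[OF that]] that n unfolding assms(7,8) by (metis dvd_pos_nat)
  then obtain r where r: "\<And>l t. l dvd n \<Longrightarrow> t \<in> totatives l \<Longrightarrow> \<exists>s<e l. \<exists>i. [t = r l s * q ^ i] (mod l)"
    by metis
  define L where "L = {l. l > 1 \<and> l dvd n}"
  have L: "{l. l dvd n} = insert 1 L" "1 \<notin> L"
    using n by (auto simp: L_def)
  have finL: "finite {l. l dvd n}" using n by simp
  define J where "J = (SIGMA l:{l. l dvd n}. {..<e l})"
  \<comment> \<open>The roots of order l are the powers of \<open>w\<close> with exponent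
    \<open>n div l\<close> times a totative of l; \<open>r l s\<close> picks one totative per orbit,
    so J enumerates the Frobenius orbits on all n-th roots of unity.\<close>
  define z where "z = (\<lambda>(l, s). w ^ (n div l * r l s))"
  let ?V = "product_group J (\<lambda>j. block_monoid (?K (fst j)))"
  have J: "finite J" using finL by (simp add: J_def)
  \<comment> \<open>The \<open>e l\<close> fields with \<open>q ^ d l\<close> elements contribute
    \<open>q ^ totient l\<close>, and the totients of the divisors of n add up to n.\<close>
  have card_prod: "(\<Prod>j\<in>J. card (?K (fst j))) = (2 ^ k) ^ n"
  proof -
    have "(\<Prod>j\<in>J. card (?K (fst j))) = (\<Prod>l | l dvd n. \<Prod>s<e l. card (?K l))"
      unfolding J_def using finL by (subst prod.Sigma) (auto simp: case_prod_unfold)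
    also have "\<dots> = (\<Prod>l | l dvd n. q ^ totient l)"
    proof (rule prod.cong)
      fix l assume l: "l \<in> {l. l dvd n}"
      then have "d l * e l = totient l"
        using order_divides_totient[OF cop] by (simp add: assms(7,8))
      then show "(\<Prod>s<e l. card (?K l)) = q ^ totient l"
        using l by (simp add: K_card flip: power_mult)
    qed simp
    also have "\<dots> = q ^ n" by (simp add: totient_divisor_sum flip: power_sum)
    finally show ?thesis by (simp add: assms(4))
  qed
  have iso: "units_of (group_algebra F (integer_mod_group n \<times>\<times> D12)) \<cong> units_of ?V"
  proof (rule units_group_algebra_iso[OF assms(1,2) two _ n J, where z = z and W = "(\<lambda>i. w ^ i) ` {..<n}"])
    fix j assume "j \<in> J"
    then obtain l s where j: "j = (l, s)" "l dvd n" by (auto simp: J_def)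
    show "z j ^ n = 1" by (simp add: z_def j w(1) power_mult[symmetric] mult.commute[of _ n]) (simp add: power_mult w(1))
    have "[q ^ d l = 1] (mod l)" unfolding assms(7) by (rule ord)
    then have "[n div l * q ^ d l = n div l * 1] (mod (n div l * l))" by (rule cong_cmult_leftI)
    then have "[n div l * q ^ d l * r l s = n div l * 1 * r l s] (mod n)"
      using j(2) by (intro cong_scalar_right) simp
    then have "w ^ (n div l * q ^ d l * r l s) = w ^ (n div l * r l s)"
      using w_cong by simp
    then show "z j ^ 2 ^ (k * d (fst j)) = z j"
      by (simp add: z_def j q_pow[symmetric] mult_ac flip: power_mult)
  next
    fix x assume "x \<in> (\<lambda>i. w ^ i) ` {..<n}"
    then obtain i where i: "i < n" "x = w ^ i" by auto
    \<comment> \<open>Totatives are positive, so the exponent 0 is replaced by n: the root 1 then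
      has \<open>l = 1\<close> and totative 1.\<close>
    define j where "j = (if i = 0 then n else i)"
    have j: "0 < j" "j \<le> n" "x = w ^ j" using i w(1) n by (auto simp: j_def)
    \<comment> \<open>The order of \<open>w ^ j\<close> is \<open>n div gcd j n\<close>, and
      dividing the exponent by the gcd leaves a totative of that order.\<close>
    define g where "g = gcd j n"
    define l where "l = n div g"
    have g: "g > 0" "g dvd j" "g dvd n" using n by (simp_all add: g_def)
    have l: "l dvd n" "n div l = g" "g * l = n" "l > 0"
      using g n by (auto simp: l_def dvd_div_eq_0_iff elim!: dvdE)
    have "coprime (j div g) l"
      unfolding g_def l_def using n by (intro div_gcd_coprime) simp
    moreover have "0 < j div g" "j div g \<le> l"
      using g j by (auto simp: l_def div_le_mono dvd_imp_le div_greater_zero_iff)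
    ultimately have "j div g \<in> totatives l" by (simp add: in_totatives_iff)
    then obtain s m where s: "s < e l" "[j div g = r l s * q ^ m] (mod l)" using r[OF l(1)] by blast
    have "[g * (j div g) = g * (r l s * q ^ m)] (mod (g * l))" using s(2) by (rule cong_cmult_leftI)
    then have "w ^ j = w ^ (g * (r l s * q ^ m))" using g l by (intro w_cong) simp
    then have "x = z (l, s) ^ (2 ^ k) ^ m"
      by (simp add: j z_def l mult.assoc assms(4) flip: power_mult)
    moreover have "(l, s) \<in> J" using l s by (simp add: J_def)
    ultimately show "\<exists>j\<in>J. \<exists>i. x = z j ^ (2 ^ k) ^ i" by blast
  qed (use cardF card_prod w(2) in \<open>simp_all add: card_image\<close>)
  let ?B = "integer_mod_group (q - 1) \<times>\<times> GL 2 F \<times>\<times>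
      product_group L (\<lambda>l. direct_power (integer_mod_group (q ^ d l - 1) \<times>\<times> GL 2 (E (d l))) (e l))"
  let ?S = "\<lambda>l. units_of (scalar_monoid (?K l))" and ?M = "\<lambda>l. units_of (matrix_monoid (?K l))"
  have units: "units_of (product_group J (\<lambda>j. residue_monoid (?K (fst j)))) =
      product_group J (\<lambda>j. ?S (fst j) \<times>\<times> ?M (fst j))"
    by (subst units_of_product_group)
      (simp_all add: units_of_DirProd monoid_residue_monoid subring_set_frobenius_fixed)
  have SM: "group (?S l)" "group (?M l)" for l
    by (intro monoid.units_group monoid_scalar_monoid monoid_matrix_monoid subring_set_frobenius_fixed)+
  have iso1: "product_group J (\<lambda>j. ?S (fst j) \<times>\<times> ?M (fst j)) \<cong>
      ?S 1 \<times>\<times> ?M 1 \<times>\<times> product_group L (\<lambda>l. direct_power (?S l \<times>\<times> ?M l) (e l))"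
    unfolding J_def L(1) using L(2) e1 by (rule product_group_Sigma_iso)
  have "?S 1 \<times>\<times> ?M 1 \<times>\<times> product_group L (\<lambda>l. direct_power (?S l \<times>\<times> ?M l) (e l)) \<cong> ?B"
  proof (intro group.DirProd_iso_trans SM)
    show "?S 1 \<cong> integer_mod_group (q - 1)" "?M 1 \<cong> GL 2 F"
      unfolding d1 assms(4) using F_groups(2,3) by simp_all
    show "product_group L (\<lambda>l. direct_power (?S l \<times>\<times> ?M l) (e l)) \<cong>
        product_group L (\<lambda>l. direct_power (integer_mod_group (q ^ d l - 1) \<times>\<times> GL 2 (E (d l))) (e l))"
      unfolding direct_power_def q_pow
      by (intro iso_product_groupI group.DirProd_iso_trans SM E_groups(2,3,4) product_group DirProd_group
          group_integer_mod_group) (auto simp: L_def)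
  qed
  with iso1 have "units_of (product_group J (\<lambda>j. residue_monoid (?K (fst j)))) \<cong> ?B"
    unfolding units by (rule iso_trans)
  moreover have "group ?B"
    unfolding direct_power_def q_pow
    by (intro product_group DirProd_group group_integer_mod_group F_groups(4) E_groups(4)) (auto simp: L_def)
  \<comment> \<open>The kernel has \<open>((2 ^ k) ^ n) ^ 7\<close> elements, which is the asserted
    power of 2.\<close>
  ultimately have "iso_semidirect_product (units_of ?V) (direct_power (integer_mod_group 2) (7 * n * k)) ?B"
    by (intro iso_semidirect_product_blocks[OF J subring_set_frobenius_fixed char_2_add_self])
      (simp_all add: card_prod mult_ac flip: power_mult)
  then show ?thesis
    unfolding L_def by (rule iso_semidirect_product_trans[OF iso])
qed

end
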